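(* Let $q$ be an odd prime power. Let $n,j,k$ be integers with $1\leq j,k\leq n-1$ and $j+k\leq n$. Let $\delta,\varepsilon,\zeta,\eta\in\{0,\pm1\}$ be such that $1\equiv n-\varepsilon\equiv j-\delta\equiv k-\zeta\equiv k+j-\eta\pmod{2}$. Then \[ \rho_{(j,\delta),(k,\zeta),(n,\varepsilon),\eta}= \begin{cases} \dfrac{\gamma_{(0,j,\delta),(n,\varepsilon),(k,\zeta),\eta}}{\alpha_{(0,k,\zeta),(n,\varepsilon)}}&\text{if } nj\text{ is even},\\[3mm] \dfrac{\sum_{\lambda\in\{\pm1\}}\alpha_{(0,j,0,\lambda),(n,0)}\,\gamma_{(0,j,0,\lambda),(n,0),(k,\zeta),\eta}}{\alpha_{(0,j,0),(n,0)}\,\alpha_{(0,k,\zeta),(n,0)}}&\text{if } nj\text{ is odd}. \end{cases} \]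
   Context: Forms and types. $q$ is an odd prime power. A quadratic form $Q$ on $\mathbb{F}_q^m$ has an associated symmetric bilinear form $f$ with $Q(v)=f(v,v)$; its radical is $\{v:\forall w,\ f(v,w)=0\}$, and $Q$ is non-degenerate if its radical is $0$. A non-degenerate quadratic form on $\mathbb{F}_q^m$ has a type: $0$ (parabolic) if $m$ is odd; if $m$ is even, the type is $1$ (hyperbolic) if the maximum dimension of a totally isotropic subspace (one on which $Q$ vanishes) is $m/2$, and $-1$ (elliptic) if it is $m/2-1$. "A quadratic form of type $\varepsilon$ on $\mathbb{F}_q^n$" always means a non-degenerate one. All subspace dimensions are vector space dimensions. Given such a form, a subspace $\pi$ is $i$-singular if the radical of the form restricted to $\pi$ has dimension $i$; non-singular means $0$-singular. The type of an $i$-singular $j$-space $\pi$ is the type of the non-degenerate form induced on $\pi/\mathrm{rad}(\pi)$. Let $\perp$ be the orthogonal polarity $\pi\mapsto\pi^\perp=\{x: f(x,y)=0\ \forall y\in\pi\}$. If $n$ and $j-i$ are both odd, the perp type of an $i$-singular $j$-space $\pi$ is the type, $1$ or $-1$, of $\pi^\perp$. Counts. Fix a quadratic form of type $\varepsilon$ on $\mathbb{F}_q^n$. $\alpha_{(i,j,\delta),(n,\varepsilon)}$ is the number of $i$-singular $j$-spaces of type $\delta$; for $n(j-i)$ odd, $\alpha_{(i,j,0,\lambda),(n,0)}$ is the number of $i$-singular $j$-spaces of perp type $\lambda$. If $n(j-i)$ is even, fix an $i$-singular $j$-space $\pi$ of type $\delta$; $\gamma_{(i,j,\delta),(n,\varepsilon),(k,\zeta),\eta}$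 is the number of non-singular $k$-spaces $\sigma$ of type $\zeta$ such that $\sigma\cap\pi$ is trivial and $\langle\pi,\sigma\rangle$ is a non-singular $(k+j)$-space of type $\eta$. If $n(j-i)$ is odd, $\gamma_{(i,j,0,\lambda),(n,0),(k,\zeta),\eta}$ is the same number for a fixed $i$-singular $j$-space $\pi$ of perp type $\lambda$. These numbers do not depend on the choice of $\pi$. Proportion. Let $\mathcal{S}_{(j,\delta),(k,\zeta)}$ be the set of pairs $(\pi,\pi')$ of non-singular subspaces with $\dim\pi=j$, $\pi$ of type $\delta$, $\dim\pi'=k$, $\pi'$ of type $\zeta$. Let $\mathcal{T}_{(j,\delta),(k,\zeta),\eta}$ be the subset of pairs such that $\dim\langle\pi,\pi'\rangle=j+k$ and $\langle\pi,\pi'\rangle$ is non-singular of type $\eta$. Then $\rho_{(j,\delta),(k,\zeta),(n,\varepsilon),\eta}=|\mathcal{T}_{(j,\delta),(k,\zeta),\eta}|/|\mathcal{S}_{(j,\delta),(k,\zeta)}|$. *)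

theory Defs
  imports "HOL-Analysis.Cartesian_Space" "HOL-Number_Theory.Cong"
begin

definition symmetric_bilinear :: "('a::field ^ 'n \<Rightarrow> 'a ^ 'n \<Rightarrow> 'a) \<Rightarrow> bool" where
  "symmetric_bilinear f \<longleftrightarrow>
     (\<forall>v w. f v w = f w v) \<and> (\<forall>v. Vector_Spaces.linear (*s) (*) (f v))"

definition quadratic_form :: "('a::field ^ 'n \<Rightarrow> 'a) \<Rightarrow> bool" where
  "quadratic_form Q \<longleftrightarrow> (\<exists>f. symmetric_bilinear f \<and> (\<forall>v. Q v = f v v))"

text \<open>In odd characteristic, this is the unique symmetric bilinear form \<open>f\<close> with
  \<open>Q v = f v v\<close>; see \<open>assoc_form_unique\<close> below.\<close>

definition assoc_form :: "('a::field ^ 'n \<Rightarrow> 'a) \<Rightarrow> 'a ^ 'n \<Rightarrow> 'a ^ 'n \<Rightarrow> 'a" where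
  "assoc_form Q v w = (Q (v + w) - Q v - Q w) / 2"

lemma assoc_form_unique:
  fixes f :: "'a::field ^ 'n \<Rightarrow> 'a ^ 'n \<Rightarrow> 'a"
  assumes "(2::'a) \<noteq> 0" and f: "symmetric_bilinear f" and Q: "\<And>v. Q v = f v v"
  shows "assoc_form Q = f"
proof (intro ext)
  fix v w
  have sym: "f x y = f y x" for x y
    using f by (simp add: symmetric_bilinear_def)
  have add: "f x (y + z) = f x y + f x z" for x y z
    using f by (simp add: symmetric_bilinear_def Vector_Spaces.linear_iff)
  have "Q (v + w) = f v v + f v w + (f v w + f w w)"
    using add[of "v + w" v w] add[of v v w] add[of w v w] sym[of "v + w" v] sym[of "v + w" w]
      sym[of w v] Q by simp
  then have "Q (v + w) - Q v - Q w = 2 * f v w"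
    using Q by (simp add: algebra_simps)
  then show "assoc_form Q v w = f v w"
    using assms(1) by (simp add: assoc_form_def)
qed

definition radical :: "('a::field ^ 'n \<Rightarrow> 'a) \<Rightarrow> ('a ^ 'n) set \<Rightarrow> ('a ^ 'n) set" where
  "radical Q W = {v \<in> W. \<forall>w\<in>W. assoc_form Q v w = 0}"

definition perp :: "('a::field ^ 'n \<Rightarrow> 'a) \<Rightarrow> ('a ^ 'n) set \<Rightarrow> ('a ^ 'n) set" where
  "perp Q W = {x. \<forall>y\<in>W. assoc_form Q x y = 0}"

definition totally_isotropic :: "('a::field ^ 'n \<Rightarrow> 'a) \<Rightarrow> ('a ^ 'n) set \<Rightarrow> bool" where
  "totally_isotropic Q U \<longleftrightarrow> vec.subspace U \<and> (\<forall>u\<in>U. Q u = 0)"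

text \<open>The maximum dimension of a totally isotropic subspace of the quotient
  \<open>W / radical Q W\<close> with the form induced by \<open>Q\<close>. The subspaces of this quotient are the
  \<open>U / radical Q W\<close> with \<open>U\<close> a subspace between \<open>radical Q W\<close> and \<open>W\<close>. If \<open>W\<close> is
  non-singular, the radical is \<open>{0}\<close> and these are just the totally isotropic subspaces
  of \<open>W\<close>.\<close>

definition max_isotropic_dim :: "('a::field ^ 'n \<Rightarrow> 'a) \<Rightarrow> ('a ^ 'n) set \<Rightarrow> nat" where
  "max_isotropic_dim Q W =
     Max {vec.dim U - vec.dim (radical Q W) | U.
            totally_isotropic Q U \<and> radical Q W \<subseteq> U \<and> U \<subseteq> W}"

text \<open>\<open>has_type Q W t\<close>: the non-degenerate form induced on \<open>W / radical Q W\<close> has type \<open>t\<close>.\<close>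

definition has_type :: "('a::field ^ 'n \<Rightarrow> 'a) \<Rightarrow> ('a ^ 'n) set \<Rightarrow> int \<Rightarrow> bool" where
  "has_type Q W t \<longleftrightarrow>
     (let m = vec.dim W - vec.dim (radical Q W); d = max_isotropic_dim Q W in
       odd m \<and> t = 0 \<or>
       even m \<and> int d = int m div 2 \<and> t = 1 \<or>
       even m \<and> int d = int m div 2 - 1 \<and> t = -1)"

definition quadratic_form_of_type :: "('a::field ^ 'n \<Rightarrow> 'a) \<Rightarrow> int \<Rightarrow> bool" where
  "quadratic_form_of_type Q t \<longleftrightarrow>
     quadratic_form Q \<and> radical Q UNIV = {0} \<and> has_type Q UNIV t"

text \<open>The \<open>i\<close>-singular \<open>j\<close>-spaces of type \<open>d\<close>.\<close>

definition singular_spaces ::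
    "('a::field ^ 'n \<Rightarrow> 'a) \<Rightarrow> nat \<Rightarrow> nat \<Rightarrow> int \<Rightarrow> ('a ^ 'n) set set" where
  "singular_spaces Q i j d =
     {W. vec.subspace W \<and> vec.dim W = j \<and> vec.dim (radical Q W) = i \<and> has_type Q W d}"

text \<open>Those of perp type \<open>l\<close>; only meaningful if the dimension of the ambient space and
  \<open>j - i\<close> are both odd, in which case \<open>d = 0\<close>.\<close>

definition singular_perp_spaces ::
    "('a::field ^ 'n \<Rightarrow> 'a) \<Rightarrow> nat \<Rightarrow> nat \<Rightarrow> int \<Rightarrow> int \<Rightarrow> ('a ^ 'n) set set" where
  "singular_perp_spaces Q i j d l =
     {W \<in> singular_spaces Q i j d. has_type Q (perp Q W) l}"

text \<open>In the following numbers the index \<open>(n, \<epsilon>)\<close> is carried by the fixed form \<open>Q\<close>.\<close>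

definition alpha :: "('a::{field,finite} ^ 'n \<Rightarrow> 'a) \<Rightarrow> nat \<Rightarrow> nat \<Rightarrow> int \<Rightarrow> nat" where
  "alpha Q i j d = card (singular_spaces Q i j d)"

definition alpha_perp ::
    "('a::{field,finite} ^ 'n \<Rightarrow> 'a) \<Rightarrow> nat \<Rightarrow> nat \<Rightarrow> int \<Rightarrow> int \<Rightarrow> nat" where
  "alpha_perp Q i j d l = card (singular_perp_spaces Q i j d l)"

definition complementary_spaces ::
    "('a::field ^ 'n \<Rightarrow> 'a) \<Rightarrow> nat \<Rightarrow> ('a ^ 'n) set \<Rightarrow> nat \<Rightarrow> int \<Rightarrow> int
      \<Rightarrow> ('a ^ 'n) set set" where
  "complementary_spaces Q j P k z h =
     {S \<in> singular_spaces Q 0 k z.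
        S \<inter> P = {0} \<and> vec.span (P \<union> S) \<in> singular_spaces Q 0 (k + j) h}"

text \<open>The choice operator renders ``fix an \<open>i\<close>-singular \<open>j\<close>-space of the given (perp) type'':
  nothing is known about the chosen space apart from this.\<close>

definition gamma ::
    "('a::{field,finite} ^ 'n \<Rightarrow> 'a) \<Rightarrow> nat \<Rightarrow> nat \<Rightarrow> int \<Rightarrow> nat \<Rightarrow> int \<Rightarrow> int \<Rightarrow> nat" where
  "gamma Q i j d k z h =
     card (complementary_spaces Q j (SOME P. P \<in> singular_spaces Q i j d) k z h)"

definition gamma_perp ::
    "('a::{field,finite} ^ 'n \<Rightarrow> 'a) \<Rightarrow> nat \<Rightarrow> nat \<Rightarrow> int \<Rightarrow> int \<Rightarrow> nat \<Rightarrow> int \<Rightarrow> int \<Rightarrow> nat" where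
  "gamma_perp Q i j d l k z h =
     card (complementary_spaces Q j (SOME P. P \<in> singular_perp_spaces Q i j d l) k z h)"

definition nonsingular_pairs ::
    "('a::field ^ 'n \<Rightarrow> 'a) \<Rightarrow> nat \<Rightarrow> int \<Rightarrow> nat \<Rightarrow> int \<Rightarrow> (('a ^ 'n) set \<times> ('a ^ 'n) set) set" where
  "nonsingular_pairs Q j d k z = singular_spaces Q 0 j d \<times> singular_spaces Q 0 k z"

definition spanning_pairs ::
    "('a::field ^ 'n \<Rightarrow> 'a) \<Rightarrow> nat \<Rightarrow> int \<Rightarrow> nat \<Rightarrow> int \<Rightarrow> int
      \<Rightarrow> (('a ^ 'n) set \<times> ('a ^ 'n) set) set" where
  "spanning_pairs Q j d k z h =
     {(P, P') \<in> nonsingular_pairs Q j d k z.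
        vec.span (P \<union> P') \<in> singular_spaces Q 0 (j + k) h}"

definition rho ::
    "('a::{field,finite} ^ 'n \<Rightarrow> 'a) \<Rightarrow> nat \<Rightarrow> int \<Rightarrow> nat \<Rightarrow> int \<Rightarrow> int \<Rightarrow> real" where
  "rho Q j d k z h =
     real (card (spanning_pairs Q j d k z h)) / real (card (nonsingular_pairs Q j d k z))"

end

(* The similitudes of the form act on all objects counted, so it suffices that they act transitively
   on the non-singular j-spaces of a given type (of a given perp type, if n and j are odd).
   Witt's extension theorem reduces this to comparing the values of Q on orthogonal bases. A
   non-singular space with a totally isotropic r-space has orthogonal vectors with values
   1, -1, ..., 1, -1 (r pairs). Hence the type of a space of even dimension determines the values of a
   suitable orthogonal basis, the last plane having values 1, -nu with nu a nonsquare in the elliptic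
   case. In odd dimension there is one undetermined square class; if n is even, it is changed by a
   similitude of the whole space with multiplier nu, which exists because the forms Q and nu Q have the
   same type. If n and j are odd, one compares the perps, whose dimension is even. *)

theory Submission
  imports Defs "HOL-Number_Theory.Residues"
begin

subsection \<open>Squares in finite fields of odd order\<close>

text \<open>Values can be prescribed because more than half of the field elements are squares. A
  plane with two orthogonal anisotropic vectors therefore takes every value, and in a non-singular
  space all but the last value of an orthogonal basis are free. The last one is fixed up to squares
  by the space itself.

  Isometries alone would not suffice. In odd dimension the spaces of one type fall into two isometry
  classes, which multiplication of the form by a nonsquare interchanges. If \<open>n\<close> is odd
  too, determinants show that every multiplier of a similitude is a square, so the two classes stay
  apart; the perp type records which one occurs.

  The forms Q and \<nu> Q have the same type because they vanish on the same subspaces. Witt's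
  theorem is proved only for orthogonal systems with nonzero values, where reflections suffice;
  totally isotropic subspaces enter only through the hyperbolic planes that they generate.

  Transitivity makes the number of admissible second components of a pair independent of the first,
  so the pairs are counted by fibres over the first component.\<close>

lemma two_neq_zero:
  assumes "odd CARD('a::{field,finite})"
  shows "(2::'a) \<noteq> 0"
proof
  assume "(2::'a) = 0"
  then have "of_nat 2 = (0::'a)"
    by simp
  then have "CHAR('a) dvd 2"
    using of_nat_eq_0_iff_char_dvd by blast
  moreover have "CHAR('a) \<noteq> 1"
    by simp
  ultimately have "CHAR('a) = 2"
    using prime_nat_iff two_is_prime_nat by blast
  then show False
    using assms CHAR_dvd_CARD[where 'a = 'a] by simp
qed

text \<open>Squaring is at most two-to-one, and one-to-one over \<open>0\<close>, so the field has
  at most 1 + 2 (\<open>card S\<close> - 1) elements. The strict inequality drives the two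
  pigeonhole arguments that follow.\<close>

lemma card_squares:
  fixes S :: "'a::{field,finite} set"
  assumes S: "S = range (\<lambda>x. x\<^sup>2)"
  shows "CARD('a) < 2 * card S"
proof -
  have fibre: "card {x::'a. x\<^sup>2 = s} \<le> 2" if s: "s \<in> S" for s
  proof -
    obtain r where "s = r\<^sup>2"
      using s S by auto
    then have "{x. x\<^sup>2 = s} \<subseteq> {r, - r}"
      using power2_eq_iff by auto
    then have "card {x. x\<^sup>2 = s} \<le> card {r, - r}"
      by (intro card_mono) auto
    also have "\<dots> \<le> 2"
      using card_insert_le_m1[of 2 "{- r}" r] by simp
    finally show ?thesis .
  qed
  have 0: "0 \<in> S"
    using S by (auto intro: range_eqI[of _ _ 0])
  have "CARD('a) = card (\<Union>s\<in>S. {x. x\<^sup>2 = s})"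
    using S by (intro arg_cong[of _ _ card]) auto
  also have "\<dots> \<le> (\<Sum>s\<in>S. card {x. x\<^sup>2 = s})"
    by (rule card_UN_le) simp
  also have "\<dots> = card {x::'a. x\<^sup>2 = 0} + (\<Sum>s\<in>S - {0}. card {x. x\<^sup>2 = s})"
    using 0 by (subst sum.remove[of S 0]) auto
  also have "card {x::'a. x\<^sup>2 = 0} = 1"
    by simp
  also have "(\<Sum>s\<in>S - {0}. card {x. x\<^sup>2 = s}) \<le> of_nat (card (S - {0})) * 2"
    by (rule sum_bounded_above) (use fibre in auto)
  also have "card (S - {0}) = card S - 1"
    using 0 by simp
  finally show ?thesis
    using 0 card_gt_0_iff[of S] by auto
qed

text \<open>The values of a x^2 and those of c - b y^2 each fill more than half of the field, so
  they meet.\<close>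

lemma binary_universal:
  fixes a b c :: "'a::{field,finite}"
  assumes "a \<noteq> 0" "b \<noteq> 0"
  shows "\<exists>x y. a * x\<^sup>2 + b * y\<^sup>2 = c"
proof -
  define S where "S = range (\<lambda>x::'a. x\<^sup>2)"
  have "card ((\<lambda>s. a * s) ` S) = card S" "card ((\<lambda>s. c - b * s) ` S) = card S"
    using assms by (auto intro!: card_image inj_onI)
  moreover have "card ((\<lambda>s. a * s) ` S \<union> (\<lambda>s. c - b * s) ` S) \<le> CARD('a)"
    by (rule card_mono) auto
  ultimately have "(\<lambda>s. a * s) ` S \<inter> (\<lambda>s. c - b * s) ` S \<noteq> {}"
    using card_squares[OF S_def] card_Un_disjoint[of "(\<lambda>s. a * s) ` S" "(\<lambda>s. c - b * s) ` S"]
    by auto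
  then obtain x y where "a * x\<^sup>2 = c - b * y\<^sup>2"
    unfolding S_def by auto
  then have "a * x\<^sup>2 + b * y\<^sup>2 = c"
    by simp
  then show ?thesis
    by blast
qed

text \<open>The squares \<open>S\<close> and their multiples by \<open>a\<close> share at most
  \<open>0\<close>. Both sets exceed half of the field, so together they cover it, and a nonsquare
  \<open>b\<close> must lie among the multiples.\<close>

lemma ratio_of_nonsquares:
  fixes a b :: "'a::{field,finite}"
  assumes a: "\<nexists>t. a = t\<^sup>2" and b: "\<nexists>t. b = t\<^sup>2"
  shows "\<exists>t. t \<noteq> 0 \<and> b = a * t\<^sup>2"
proof -
  define S where "S = range (\<lambda>x::'a. x\<^sup>2)"
  have a0: "a \<noteq> 0" and b0: "b \<noteq> 0"
    using a b by (metis zero_power2)+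
  have "(\<lambda>s. a * s) ` S \<inter> S \<subseteq> {0}"
  proof
    fix z assume "z \<in> (\<lambda>s. a * s) ` S \<inter> S"
    then obtain x y where "z = a * x\<^sup>2" "z = y\<^sup>2"
      unfolding S_def by blast
    then have "x \<noteq> 0 \<Longrightarrow> a = (y / x)\<^sup>2"
      by (simp add: power_divide nonzero_eq_divide_eq)
    then show "z \<in> {0}"
      using a \<open>z = a * x\<^sup>2\<close> by auto
  qed
  then have "card ((\<lambda>s. a * s) ` S \<inter> S) \<le> 1"
    using card_mono[of "{0::'a}"] by fastforce
  moreover have "card ((\<lambda>s. a * s) ` S) = card S"
    using a0 by (auto intro!: card_image inj_onI)
  ultimately have "CARD('a) \<le> card ((\<lambda>s. a * s) ` S \<union> S)"
    using card_squares[OF S_def] card_Un_Int[of "(\<lambda>s. a * s) ` S" S] by simp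
  then have "(\<lambda>s. a * s) ` S \<union> S = UNIV"
    by (intro card_seteq) auto
  then have "b \<in> (\<lambda>s. a * s) ` S"
    using b unfolding S_def by blast
  then obtain t where "b = a * t\<^sup>2"
    unfolding S_def by auto
  then show ?thesis
    using b0 by (intro exI[of _ t]) auto
qed

lemma nonsquare_exists:
  assumes "odd CARD('a::{field,finite})"
  shows "\<exists>c::'a. \<nexists>t. c = t\<^sup>2"
proof (rule ccontr)
  assume "\<not> ?thesis"
  then have "surj (\<lambda>t::'a. t\<^sup>2)"
    by (auto simp: surj_def)
  then have "inj (\<lambda>t::'a. t\<^sup>2)"
    by (simp add: finite_UNIV_surj_inj)
  then have "(1::'a) = - 1"
    by (rule injD) simp
  then have "(2::'a) = 0"
    by (metis one_add_one add.right_inverse)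
  then show False
    using two_neq_zero[OF assms] by simp
qed

subsection \<open>Orthogonal systems\<close>

primrec hyp :: "nat \<Rightarrow> 'a::field list" where
  "hyp 0 = []"
| "hyp (Suc r) = 1 # - 1 # hyp r"

lemma length_hyp [simp]: "length (hyp r) = 2 * r"
  by (induction r) auto

lemma hyp_nonzero: "(0::'a::field) \<notin> set (hyp r)"
  by (induction r) auto

text \<open>The recursion exposes the first pair; comparison with elliptic values needs the last
  one.\<close>

lemma hyp_Suc_snoc: "hyp (Suc r) = hyp r @ [1, - 1]"
  by (induction r) auto

text \<open>Intended for a nonsquare \<open>\<nu>\<close>, so that the last two values of the case \<open>d = -1\<close> span an
  anisotropic plane.\<close>

definition type_values :: "'a::field \<Rightarrow> int \<Rightarrow> nat \<Rightarrow> 'a list" where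
  "type_values \<nu> d r = (if d = 1 then hyp r else hyp (r - 1) @ [1, - \<nu>])"

text \<open>For \<open>d = -1\<close> and \<open>r = 0\<close> the subtraction \<open>r - 1\<close>
  truncates and the list still has two entries, hence the condition.\<close>

lemma length_type_values: "r \<ge> 1 \<or> d = 1 \<Longrightarrow> length (type_values \<nu> d r) = 2 * r"
  by (auto simp: type_values_def)

text \<open>Only a form is fixed, because \<open>nonsquare_similitude\<close> interprets the locale
  a second time, for the multiple of \<open>Q\<close> by a nonsquare.\<close>

locale quad_space =
  fixes Q :: "'a::{field,finite} ^ 'n \<Rightarrow> 'a"
  assumes odd_card: "odd CARD('a)" and form: "quadratic_form Q"
begin

abbreviation B :: "'a ^ 'n \<Rightarrow> 'a ^ 'n \<Rightarrow> 'a" where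
  "B \<equiv> assoc_form Q"

lemma two: "(2::'a) \<noteq> 0"
  using two_neq_zero[OF odd_card] .

lemma bilinear: "symmetric_bilinear B" and Q_eq: "Q v = B v v"
proof -
  obtain f where "symmetric_bilinear f" "\<And>v. Q v = f v v"
    using form unfolding quadratic_form_def by auto
  then have "assoc_form Q = f" "Q v = f v v" "symmetric_bilinear f"
    using assoc_form_unique two by auto
  then show "symmetric_bilinear B" "Q v = B v v"
    by auto
qed

lemma B_sym: "B v w = B w v"
  using bilinear by (simp add: symmetric_bilinear_def)

lemma B_linear: "Vector_Spaces.linear (*s) (*) (B v)"
  using bilinear by (simp add: symmetric_bilinear_def)

lemma B_simps [simp]:
  "B v (x + y) = B v x + B v y" "B (x + y) v = B x v + B y v"
  "B v (c *s x) = c * B v x" "B (c *s x) v = c * B x v"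
  "B v (x - y) = B v x - B v y" "B (x - y) v = B x v - B y v"
  "B v 0 = 0" "B 0 v = 0"
  "B v (- x) = - B v x" "B (- x) v = - B x v"
proof -
  interpret L: Vector_Spaces.linear "(*s)" "(*)" "B v" for v
    by (rule B_linear)
  show
    "B v (x + y) = B v x + B v y" "B (x + y) v = B x v + B y v"
    "B v (c *s x) = c * B v x" "B (c *s x) v = c * B x v"
    "B v (x - y) = B v x - B v y" "B (x - y) v = B x v - B y v"
    "B v 0 = 0" "B 0 v = 0"
    "B v (- x) = - B v x" "B (- x) v = - B x v"
    using B_sym L.add L.scale L.diff L.zero L.neg by metis+
qed

lemma Q_scale [simp]: "Q (c *s x) = c\<^sup>2 * Q x"
  by (simp add: Q_eq power2_eq_square)

lemma B_span_zero:
  assumes "y \<in> vec.span S" and "\<And>x. x \<in> S \<Longrightarrow> B v x = 0"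
  shows "B v y = 0"
  using assms(1) by (induction rule: vec.span_induct_alt) (use assms(2) in auto)

text \<open>Lists rather than sets, so that \<open>map Q xs\<close> is the diagonal Gram matrix and
  two systems can be compared entry by entry. Nonzero values make the spans non-singular.\<close>

fun orth :: "('a ^ 'n) list \<Rightarrow> bool" where
  "orth [] = True"
| "orth (x # xs) = (Q x \<noteq> 0 \<and> (\<forall>y\<in>set xs. B x y = 0) \<and> orth xs)"

lemma orth_append:
  "orth (xs @ ys) \<longleftrightarrow> orth xs \<and> orth ys \<and> (\<forall>x\<in>set xs. \<forall>y\<in>set ys. B x y = 0)"
  by (induction xs) auto

lemma orth_Q: "orth xs \<Longrightarrow> x \<in> set xs \<Longrightarrow> Q x \<noteq> 0"
  by (induction xs) auto

lemma orth_projection: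
  assumes "orth xs"
  shows "\<exists>u\<in>vec.span (set xs). \<forall>x\<in>set xs. B (v - u) x = 0"
  using assms
proof (induction xs)
  case Nil
  then show ?case by simp
next
  case (Cons x xs)
  then obtain u where u: "u \<in> vec.span (set xs)" "\<forall>y\<in>set xs. B (v - u) y = 0"
    by auto
  \<comment> \<open>Gram-Schmidt: a multiple of \<open>x\<close> does not disturb orthogonality to
    \<open>xs\<close>, and this coefficient makes the remainder orthogonal to
    \<open>x\<close>.\<close>
  define w where "w = u + (B (v - u) x / Q x) *s x"
  have "w \<in> vec.span (set (x # xs))"
    unfolding w_def using u(1)
    by (intro vec.span_add vec.span_scale) (auto intro: vec.span_base vec.span_mono[THEN subsetD])
  moreover have "B (v - w) y = 0" if "y \<in> set (x # xs)" for y
  proof -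
    have "Q x \<noteq> 0" "\<forall>y\<in>set xs. B x y = 0"
      using Cons.prems by auto
    then show ?thesis
      using that u(2) by (auto simp: w_def Q_eq[of x, symmetric])
  qed
  ultimately show ?case
    by blast
qed

lemma orth_span_zero:
  assumes "orth xs" "v \<in> vec.span (set xs)" "\<And>x. x \<in> set xs \<Longrightarrow> B v x = 0"
  shows "v = 0"
  using assms
proof (induction xs)
  case Nil
  then show ?case by simp
next
  case (Cons x xs)
  then obtain k where k: "v - k *s x \<in> vec.span (set xs)"
    using vec.span_breakdown_eq[of v x "set xs"] by auto
  then have "B x (v - k *s x) = 0"
    by (rule B_span_zero) (use Cons.prems in auto)
  then have "k * Q x = 0"
    using Cons.prems(3)[of x] by (simp add: Q_eq B_sym)
  then have "v \<in> vec.span (set xs)"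
    using Cons.prems(1) k by simp
  then show ?case
    using Cons by simp
qed

lemma orth_not_in_span:
  assumes "orth (x # xs)"
  shows "x \<notin> vec.span (set xs)"
  using B_span_zero[of x "set xs" x] assms by (auto simp: Q_eq)

lemma orth_dim_span: "orth xs \<Longrightarrow> vec.dim (vec.span (set xs)) = length xs"
proof (induction xs)
  case Nil
  then show ?case by simp
next
  case (Cons x xs)
  then show ?case
    using orth_not_in_span[OF Cons.prems] by (simp add: vec.dim_insert)
qed

lemma orth_independent: "orth xs \<Longrightarrow> vec.independent (set xs) \<and> distinct xs"
proof (induction xs)
  case Nil
  then show ?case by (simp add: vec.independent_empty)
next
  case (Cons x xs)
  then show ?case
    using orth_not_in_span[OF Cons.prems] vec.span_base[of x "set xs"]
      vec.independent_insertI[of x "set xs"] by auto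
qed

section \<open>Non-singular subspaces and extension of orthogonal systems\<close>

definition nonsing :: "('a ^ 'n) set \<Rightarrow> bool" where
  "nonsing W \<longleftrightarrow> vec.subspace W \<and> radical Q W = {0}"

lemma nonsing_iff:
  "nonsing W \<longleftrightarrow> vec.subspace W \<and> (\<forall>v\<in>W. (\<forall>w\<in>W. B v w = 0) \<longrightarrow> v = 0)"
  unfolding nonsing_def radical_def using vec.subspace_0 by auto

lemma subspace_radical: "vec.subspace W \<Longrightarrow> vec.subspace (radical Q W)"
  unfolding radical_def
  by (rule vec.subspaceI) (auto intro: vec.subspace_0 vec.subspace_add vec.subspace_scale)

lemma nonsing_dim: "nonsing W \<longleftrightarrow> vec.subspace W \<and> vec.dim (radical Q W) = 0"
  unfolding nonsing_def using subspace_radical vec.subspace_0 by fastforce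

lemma nonsing_orth_span:
  assumes "orth xs"
  shows "nonsing (vec.span (set xs))"
  unfolding nonsing_iff using orth_span_zero[OF assms] vec.span_base by auto

lemma span_orth_eq:
  assumes "orth xs" "set xs \<subseteq> W" "vec.subspace W" "vec.dim W = length xs"
  shows "vec.span (set xs) = W"
  using vec.span_minimal[OF assms(2,3)] orth_dim_span[OF assms(1)] assms(3,4)
  by (intro vec.subspace_dim_equal) auto

lemma orth_length_le:
  assumes "orth xs" "set xs \<subseteq> W"
  shows "length xs \<le> vec.dim W"
  using orth_dim_span[OF assms(1)] vec.dim_subset[OF assms(2)] by simp

text \<open>Some \<open>w\<close> in \<open>W\<close> pairs nontrivially with \<open>u\<close>.
  Subtracting its projection to the span of \<open>xs\<close> leaves \<open>B u w\<close> unchanged,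
  since \<open>u\<close> is orthogonal to that span.\<close>

lemma orth_complement_pair:
  assumes W: "nonsing W" and xs: "orth xs" "set xs \<subseteq> W"
    and u: "u \<in> W" "u \<noteq> 0" "\<forall>x\<in>set xs. B u x = 0"
  shows "\<exists>v\<in>W. (\<forall>x\<in>set xs. B v x = 0) \<and> B u v \<noteq> 0"
proof -
  obtain w where w: "w \<in> W" "B u w \<noteq> 0"
    using W u unfolding nonsing_iff by auto
  obtain p where p: "p \<in> vec.span (set xs)" "\<forall>x\<in>set xs. B (w - p) x = 0"
    using orth_projection[OF xs(1)] by blast
  have "p \<in> W"
    using p(1) xs(2) W vec.span_minimal unfolding nonsing_def by blast
  then have "w - p \<in> W"
    using w W unfolding nonsing_def by (auto intro: vec.subspace_diff)
  moreover have "B u (w - p) \<noteq> 0"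
    using w B_span_zero[OF p(1), of u] u(3) by simp
  ultimately show ?thesis
    using p(2) by blast
qed

lemma polarization: "4 * B u v = Q (u + v) - Q (u - v)"
  by (simp add: Q_eq B_sym[of v u])

lemma four: "(4::'a) \<noteq> 0"
  using two by (metis mult_eq_0_iff mult_2 numeral_Bit0)

lemma orth_extend_one:
  assumes W: "nonsing W" and xs: "orth xs" "set xs \<subseteq> W" and "length xs < vec.dim W"
  shows "\<exists>y\<in>W. orth (xs @ [y])"
proof -
  have "\<not> W \<subseteq> vec.span (set xs)"
    using assms(4) orth_dim_span[OF xs(1)] vec.dim_subset[of W "vec.span (set xs)"] by auto
  then obtain w where w: "w \<in> W" "w \<notin> vec.span (set xs)"
    by blast
  obtain p where p: "p \<in> vec.span (set xs)" "\<forall>x\<in>set xs. B (w - p) x = 0"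
    using orth_projection[OF xs(1)] by blast
  define u where "u = w - p"
  have sub: "vec.subspace W"
    using W unfolding nonsing_def by simp
  have "p \<in> W"
    using p(1) xs(2) sub vec.span_minimal by blast
  then have u: "u \<in> W" "u \<noteq> 0" "\<forall>x\<in>set xs. B u x = 0"
    using w p sub unfolding u_def by (auto intro: vec.subspace_diff)
  then obtain v where v: "v \<in> W" "\<forall>x\<in>set xs. B v x = 0" "B u v \<noteq> 0"
    using orth_complement_pair[OF W xs] by blast
  \<comment> \<open>By polarization, the form cannot vanish at both vectors when \<open>u\<close>
    and \<open>v\<close> pair nontrivially.\<close>
  then have "Q (u + v) \<noteq> 0 \<or> Q (u - v) \<noteq> 0"
    using polarization[of u v] four by auto
  then obtain y where "Q y \<noteq> 0" "y = u + v \<or> y = u - v"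
    by blast
  moreover from this have "y \<in> W"
    using u v sub by (auto intro: vec.subspace_add vec.subspace_diff)
  moreover have "\<forall>x\<in>set xs. B x u = 0 \<and> B x v = 0"
    using u(3) v(2) B_sym by metis
  ultimately show ?thesis
    using xs(1) unfolding orth_append by (intro bexI[of _ y]) auto
qed

lemma orth_extend:
  assumes W: "nonsing W" and xs: "orth xs" "set xs \<subseteq> W"
  shows "\<exists>ys. orth (xs @ ys) \<and> set ys \<subseteq> W \<and> length xs + length ys = vec.dim W"
  using xs
proof (induction "vec.dim W - length xs" arbitrary: xs)
  case 0
  then show ?case
    using orth_length_le[of xs W] by (intro exI[of _ "[]"]) auto
next
  case (Suc d)
  then have "length xs < vec.dim W"
    by linarith
  then obtain y where y: "y \<in> W" "orth (xs @ [y])"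
    using orth_extend_one[OF W, of xs] Suc.prems by auto
  moreover have "d = vec.dim W - length (xs @ [y])"
    using Suc.hyps(2) by simp
  ultimately obtain ys where "orth ((xs @ [y]) @ ys)" "set ys \<subseteq> W"
    "length (xs @ [y]) + length ys = vec.dim W"
    using Suc.hyps(1)[of "xs @ [y]"] Suc.prems by auto
  then show ?case
    using y by (intro exI[of _ "y # ys"]) auto
qed

text \<open>Two spare dimensions leave a plane with orthogonal basis \<open>a\<close>,
  \<open>b\<close> beside \<open>xs\<close>, and its binary form is universal.\<close>

lemma orth_extend_value:
  assumes W: "nonsing W" and xs: "orth xs" "set xs \<subseteq> W" and len: "length xs + 2 \<le> vec.dim W"
    and c: "c \<noteq> 0"
  shows "\<exists>y\<in>W. orth (xs @ [y]) \<and> Q y = c"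
proof -
  obtain ys where ys: "orth (xs @ ys)" "set ys \<subseteq> W" "length xs + length ys = vec.dim W"
    using orth_extend[OF W xs] by blast
  then obtain a b zs where eq: "ys = a # b # zs"
    using len by (cases ys; cases "tl ys") auto
  have ab: "Q a \<noteq> 0" "Q b \<noteq> 0" "B a b = 0" "a \<in> W" "b \<in> W"
    and ort: "\<forall>x\<in>set xs. B x a = 0 \<and> B x b = 0"
    using ys eq unfolding orth_append by auto
  obtain s t where "Q a * s\<^sup>2 + Q b * t\<^sup>2 = c"
    using binary_universal[OF ab(1,2)] by blast
  then have "Q (s *s a + t *s b) = c"
    using ab(3) by (simp add: Q_eq B_sym[of b a] power2_eq_square mult_ac)
  moreover have "s *s a + t *s b \<in> W"
    using ab W unfolding nonsing_def by (auto intro: vec.subspace_add vec.subspace_scale)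
  ultimately show ?thesis
    using c ort ys(1) unfolding orth_append by (intro bexI[of _ "s *s a + t *s b"]) auto
qed

text \<open>The strict inequality keeps one dimension in reserve: each new value needs a plane to
  choose from.\<close>

lemma orth_extend_values:
  assumes W: "nonsing W"
  shows "orth xs \<Longrightarrow> set xs \<subseteq> W \<Longrightarrow> length xs + length cs < vec.dim W \<Longrightarrow> 0 \<notin> set cs \<Longrightarrow>
    \<exists>ys. orth (xs @ ys) \<and> set ys \<subseteq> W \<and> map Q ys = cs"
proof (induction cs arbitrary: xs)
  case Nil
  then show ?case by (intro exI[of _ "[]"]) simp
next
  case (Cons c cs)
  then obtain y where y: "y \<in> W" "orth (xs @ [y])" "Q y = c"
    using orth_extend_value[OF W, of xs c] by auto
  then obtain ys where "orth ((xs @ [y]) @ ys)" "set ys \<subseteq> W" "map Q ys = cs"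
    using Cons.IH[of "xs @ [y]"] Cons.prems by auto
  then show ?case
    using y by (intro exI[of _ "y # ys"]) auto
qed

section \<open>Totally isotropic subspaces and hyperbolic planes\<close>

lemma totally_isotropic_B:
  assumes "totally_isotropic Q U" "u \<in> U" "v \<in> U"
  shows "B u v = 0"
proof -
  have "u + v \<in> U" "u - v \<in> U"
    using assms unfolding totally_isotropic_def
    by (auto intro: vec.subspace_add vec.subspace_diff)
  then show ?thesis
    using polarization[of u v] assms four unfolding totally_isotropic_def by auto
qed

text \<open>Each isotropic vector has a partner spanning a hyperbolic plane with it, and such a plane has
  an orthogonal basis with values \<open>1\<close> and \<open>-1\<close>. The prefix \<open>zs\<close> collects the planes already split
  off.\<close>

lemma isotropic_imp_hyp:
  assumes W: "nonsing W"
  shows "orth zs \<Longrightarrow> set zs \<subseteq> W \<Longrightarrow> totally_isotropic Q U \<Longrightarrow> U \<subseteq> W \<Longrightarrow>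
    (\<forall>u\<in>U. \<forall>z\<in>set zs. B u z = 0) \<Longrightarrow> r \<le> vec.dim U \<Longrightarrow>
    \<exists>xs. orth (zs @ xs) \<and> set xs \<subseteq> W \<and> map Q xs = hyp r"
proof (induction r arbitrary: zs U)
  case 0
  then show ?case by (intro exI[of _ "[]"]) simp
next
  case (Suc r)
  have sub: "vec.subspace W" "vec.subspace U"
    using W Suc.prems unfolding nonsing_def totally_isotropic_def by auto
  have "\<not> U \<subseteq> {0}"
    using Suc.prems(6) vec.dim_eq_0[of U] by (metis Suc_n_not_le_n le_0_eq nat.distinct(1))
  then obtain u where u: "u \<in> U" "u \<noteq> 0"
    by blast
  then obtain v0 where v0: "v0 \<in> W" "\<forall>z\<in>set zs. B v0 z = 0" "B u v0 \<noteq> 0"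
    using orth_complement_pair[OF W Suc.prems(1,2), of u] Suc.prems by auto
  define v1 where "v1 = (1 / B u v0) *s v0"
  \<comment> \<open>The correction by a multiple of the isotropic \<open>u\<close> keeps the pairing
    with \<open>u\<close> equal to 1 and makes \<open>v\<close> isotropic.\<close>
  define v where "v = v1 - (Q v1 / 2) *s u"
  have v1: "v1 \<in> W" "\<forall>z\<in>set zs. B v1 z = 0" "B u v1 = 1"
    using v0 sub by (auto simp: v1_def intro: vec.subspace_scale)
  have Qu: "Q u = 0" "B u u = 0"
    using u Suc.prems(3) Q_eq unfolding totally_isotropic_def by auto
  have v: "v \<in> W" "\<forall>z\<in>set zs. B v z = 0" "B u v = 1"
    using v1 sub u Suc.prems Qu
    by (auto simp: v_def intro: vec.subspace_scale vec.subspace_diff)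
  have Bvv: "B v v = 0"
    using v1(3) Qu two by (simp add: v_def Q_eq B_sym[of v1 u])
  \<comment> \<open>With \<open>u\<close>, \<open>v\<close> isotropic and \<open>B u v = 1\<close>,
    the factor 1/2 gives the values 1 and -1.\<close>
  define x where "x = u + (1/2) *s v"
  define y where "y = u - (1/2) *s v"
  have xy: "x \<in> W" "y \<in> W"
    unfolding x_def y_def using u v sub Suc.prems(4)
    by (auto intro: vec.subspace_add vec.subspace_diff vec.subspace_scale)
  have vals: "Q x = 1" "Q y = - 1" "B x y = 0"
    using Bvv v(3) Qu two by (auto simp: x_def y_def Q_eq B_sym[of v u])
  have ortz: "\<forall>z\<in>set zs. B z x = 0 \<and> B z y = 0"
    using v(2) Suc.prems(5) u(1) B_sym by (auto simp: x_def y_def)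
  have orth: "orth (zs @ [x, y])"
    using vals ortz Suc.prems(1) unfolding orth_append by auto
  \<comment> \<open>The rest of \<open>U\<close> must be orthogonal to the new plane. Orthogonality
    to \<open>u\<close> is automatic in \<open>U\<close>; that to \<open>v\<close> cuts out a
    complement of the line of \<open>u\<close>, so only one dimension is lost.\<close>
  define U' where "U' = {w \<in> U. B w v = 0}"
  have tiU': "totally_isotropic Q U'"
    using Suc.prems(3) sub unfolding totally_isotropic_def U'_def
    by (auto intro!: vec.subspaceI intro: vec.subspace_0 vec.subspace_add vec.subspace_scale)
  have "U \<subseteq> vec.span (insert u U')"
  proof
    fix w assume w: "w \<in> U"
    have "w - (B w v) *s u \<in> U'"
      using w u sub v(3) unfolding U'_def by (auto intro: vec.subspace_diff vec.subspace_scale)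
    then show "w \<in> vec.span (insert u U')"
      using vec.span_breakdown_eq vec.span_base by blast
  qed
  then have "vec.dim U \<le> vec.dim (insert u U')"
    by (rule vec.dim_mono)
  then have dim: "r \<le> vec.dim U'"
    using Suc.prems(6) by (simp add: vec.dim_insert split: if_splits)
  have "\<forall>w\<in>U'. B w u = 0"
    using totally_isotropic_B[OF Suc.prems(3)] u(1) unfolding U'_def by auto
  then have ortU': "\<forall>w\<in>U'. \<forall>z\<in>set (zs @ [x, y]). B w z = 0"
    using Suc.prems(5) unfolding U'_def by (simp add: x_def y_def)
  have "set (zs @ [x, y]) \<subseteq> W" "U' \<subseteq> W"
    using xy Suc.prems(2,4) unfolding U'_def by auto
  from Suc.IH[OF orth this(1) tiU' this(2) ortU' dim]
  obtain xs where "orth ((zs @ [x, y]) @ xs)" "set xs \<subseteq> W" "map Q xs = hyp r"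
    by blast
  then show ?case
    using xy vals by (intro exI[of _ "x # y # xs"]) auto
qed

text \<open>Each pair \<open>x\<close>, \<open>y\<close> with values 1 and -1 contributes the
  isotropic vector \<open>x + y\<close>. It lies outside the span of the previous ones, which are
  orthogonal to \<open>x\<close>, because \<open>B x (x + y) = 1\<close>.\<close>

lemma hyp_imp_isotropic:
  "orth xs \<Longrightarrow> map Q xs = hyp r @ ds \<Longrightarrow>
    \<exists>U\<subseteq>vec.span (set xs). totally_isotropic Q U \<and> vec.dim U = r"
proof (induction r arbitrary: xs)
  case 0
  have "totally_isotropic Q {0}"
    unfolding totally_isotropic_def by (simp add: Q_eq)
  then show ?case
    by (intro exI[of _ "{0}"]) (auto simp: vec.span_zero)
next
  case (Suc r)
  then obtain x y zs where xs: "xs = x # y # zs" "Q x = 1" "Q y = - 1" "map Q zs = hyp r @ ds"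
    by (auto simp: map_eq_Cons_conv)
  then obtain U where U: "U \<subseteq> vec.span (set zs)" "totally_isotropic Q U" "vec.dim U = r"
    using Suc.IH[of zs] Suc.prems(1) by auto
  have subU: "vec.subspace U"
    using U unfolding totally_isotropic_def by simp
  define U' where "U' = vec.span (insert (x + y) U)"
  have x: "B x u = 0" "B y u = 0" if "u \<in> vec.span (set zs)" for u
    using that Suc.prems(1) xs(1) by (auto intro: B_span_zero)
  have Bxy: "B x y = 0" "B y x = 0"
    using Suc.prems(1) xs(1) B_sym[of x y] by auto
  have "x + y \<notin> vec.span U"
  proof
    assume "x + y \<in> vec.span U"
    then have "B x (x + y) = 0"
      using x(1) U(1) subU vec.span_eq_iff by blast
    then show False
      using xs Bxy by (simp add: Q_eq)
  qed
  then have "vec.dim U' = Suc r"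
    unfolding U'_def using U(3) by (simp add: vec.dim_insert)
  moreover have "totally_isotropic Q U'"
    unfolding totally_isotropic_def
  proof (intro conjI ballI)
    fix w assume "w \<in> U'"
    then obtain k where "w - k *s (x + y) \<in> U"
      unfolding U'_def using subU vec.span_breakdown_eq vec.span_eq_iff by blast
    then obtain u where u: "u \<in> U" "w = k *s (x + y) + u"
      by (metis add.commute diff_add_cancel)
    have "Q u = 0" "B x u = 0" "B y u = 0" "B u x = 0" "B u y = 0"
      using u U x B_sym unfolding totally_isotropic_def by auto
    then show "Q w = 0"
      using u(2) xs Bxy by (simp add: Q_eq)
  qed (simp add: U'_def)
  moreover have "U' \<subseteq> vec.span (set xs)"
    unfolding U'_def
  proof (rule vec.span_minimal)
    show "insert (x + y) U \<subseteq> vec.span (set xs)"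
      using U(1) xs(1) vec.span_mono[of "set zs" "set xs"]
      by (auto intro: vec.span_add vec.span_base)
  qed simp
  ultimately show ?case
    by blast
qed

subsection \<open>Similitudes and Witt extension\<close>

definition similitude :: "'a \<Rightarrow> ('a ^ 'n \<Rightarrow> 'a ^ 'n) \<Rightarrow> bool" where
  "similitude \<mu> g \<longleftrightarrow>
     Vector_Spaces.linear (*s) (*s) g \<and> bij g \<and> \<mu> \<noteq> 0 \<and> (\<forall>v. Q (g v) = \<mu> * Q v)"

lemma similitude_B:
  assumes "similitude \<mu> g"
  shows "B (g v) (g w) = \<mu> * B v w"
proof -
  have "g v + g w = g (v + w)"
    using assms by (simp add: similitude_def Vector_Spaces.linear_iff)
  then show ?thesis
    using assms by (simp add: similitude_def assoc_form_def algebra_simps)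
qed

lemma similitude_id: "similitude 1 id"
  by (simp add: similitude_def vec.linear_id)

lemma similitude_comp:
  "similitude \<mu> g \<Longrightarrow> similitude \<nu> h \<Longrightarrow> similitude (\<nu> * \<mu>) (h \<circ> g)"
  by (auto simp: similitude_def intro: Vector_Spaces.linear_compose bij_comp)

lemma similitude_image:
  assumes "similitude \<mu> g"
  shows similitude_subspace: "vec.subspace (g ` W) \<longleftrightarrow> vec.subspace W"
    and similitude_span: "g ` vec.span S = vec.span (g ` S)"
    and similitude_dim: "vec.dim (g ` W) = vec.dim W"
    and similitude_inj: "inj g" and similitude_0: "g 0 = 0"
proof -
  interpret g: Vector_Spaces.linear "(*s)" "(*s)" g
    using assms by (simp add: similitude_def)
  show inj: "inj g"
    using assms by (simp add: similitude_def bij_is_inj)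
  have "g -` g ` W = W"
    using inj by (rule inj_vimage_image_eq)
  then show "vec.subspace (g ` W) \<longleftrightarrow> vec.subspace W"
    using g.subspace_image g.subspace_vimage by metis
  show "g ` vec.span S = vec.span (g ` S)"
    by (simp add: g.span_image)
  show "vec.dim (g ` W) = vec.dim W"
    using inj by (intro vec.dim_image_eq) (auto intro: g.linear_axioms inj_on_subset)
  show "g 0 = 0"
    by (rule g.zero)
qed

lemma similitude_radical:
  assumes "similitude \<mu> g"
  shows "radical Q (g ` W) = g ` radical Q W"
  using assms similitude_B[OF assms] by (auto simp: radical_def similitude_def)

lemma similitude_perp:
  assumes "similitude \<mu> g"
  shows "perp Q (g ` W) = g ` perp Q W"
proof -
  have "surj g" "\<mu> \<noteq> 0"
    using assms by (auto simp: similitude_def bij_is_surj)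
  have "x \<in> g ` perp Q W" if "x \<in> perp Q (g ` W)" for x
  proof -
    obtain y where "x = g y"
      using \<open>surj g\<close> by (auto simp: surj_def)
    then show ?thesis
      using that \<open>\<mu> \<noteq> 0\<close> similitude_B[OF assms] by (auto simp: perp_def)
  qed
  then show ?thesis
    using similitude_B[OF assms] by (auto simp: perp_def)
qed

lemma similitude_isotropic:
  assumes "similitude \<mu> g"
  shows "totally_isotropic Q (g ` U) \<longleftrightarrow> totally_isotropic Q U"
  using assms similitude_subspace[OF assms] by (auto simp: totally_isotropic_def similitude_def)

lemma similitude_max_isotropic_dim:
  assumes g: "similitude \<mu> g"
  shows "max_isotropic_dim Q (g ` W) = max_isotropic_dim Q W"
proof -
  have "{vec.dim U - vec.dim (radical Q (g ` W)) | U.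
      totally_isotropic Q U \<and> radical Q (g ` W) \<subseteq> U \<and> U \<subseteq> g ` W} =
    {vec.dim (g ` U) - vec.dim (radical Q (g ` W)) | U.
      totally_isotropic Q (g ` U) \<and> radical Q (g ` W) \<subseteq> g ` U \<and> g ` U \<subseteq> g ` W}"
    (is "{?f U | U. ?P U} = _")
  proof -
    \<comment> \<open>Every subset of the image of \<open>W\<close> is itself an image under
      \<open>g\<close>, so the index set can be changed.\<close>
    have "(\<exists>U. m = ?f U \<and> ?P U) \<longleftrightarrow> (\<exists>U. m = ?f (g ` U) \<and> ?P (g ` U))" for m
      by (metis subset_imageE)
    then show ?thesis
      by (intro Collect_cong)
  qed
  then show ?thesis
    unfolding max_isotropic_dim_def
    by (simp add: similitude_radical[OF g] similitude_dim[OF g] similitude_isotropic[OF g]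
        inj_image_subset_iff[OF similitude_inj[OF g]])
qed

lemma similitude_has_type:
  assumes "similitude \<mu> g"
  shows "has_type Q (g ` W) d \<longleftrightarrow> has_type Q W d"
  unfolding has_type_def
  by (simp add: similitude_max_isotropic_dim[OF assms] similitude_radical[OF assms]
      similitude_dim[OF assms])

lemma similitude_singular_spaces:
  assumes "similitude \<mu> g"
  shows "g ` W \<in> singular_spaces Q i j d \<longleftrightarrow> W \<in> singular_spaces Q i j d"
  unfolding singular_spaces_def
  by (simp add: similitude_has_type[OF assms] similitude_radical[OF assms]
      similitude_dim[OF assms] similitude_subspace[OF assms])

lemma similitude_complementary_spaces:
  assumes g: "similitude \<mu> g" and S: "S \<in> complementary_spaces Q j P k z h"
  shows "g ` S \<in> complementary_spaces Q j (g ` P) k z h"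
proof -
  have "g ` S \<inter> g ` P = g ` (S \<inter> P)"
    using image_Int[OF similitude_inj[OF g]] by simp
  moreover have "vec.span (g ` P \<union> g ` S) = g ` vec.span (P \<union> S)"
    using similitude_span[OF g] by (simp add: image_Un)
  ultimately show ?thesis
    using S similitude_singular_spaces[OF g] similitude_0[OF g]
    by (simp add: complementary_spaces_def)
qed

text \<open>Taking images is injective, which gives one inequality. The other comes later from a
  similitude in the opposite direction, so no inverse of \<open>g\<close> has to be studied.\<close>

lemma similitude_card_complementary_spaces:
  assumes "similitude \<mu> g"
  shows "card (complementary_spaces Q j P k z h) \<le> card (complementary_spaces Q j (g ` P) k z h)"
proof (rule card_inj_on_le[of "(`) g"])
  show "inj_on ((`) g) (complementary_spaces Q j P k z h)"
    using inj_image_eq_iff[OF similitude_inj[OF assms]] by (auto intro: inj_onI)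
qed (use similitude_complementary_spaces[OF assms] in auto)

lemma similitude_orth:
  assumes "similitude \<mu> g" "orth xs"
  shows "orth (map g xs)"
  using assms(2)
  by (induction xs) (use assms(1) similitude_B[OF assms(1)] in \<open>auto simp: similitude_def\<close>)

section \<open>Reflections and Witt's theorem\<close>

definition reflection :: "'a ^ 'n \<Rightarrow> 'a ^ 'n \<Rightarrow> 'a ^ 'n" where
  "reflection a v = v - (2 * B v a / Q a) *s a"

lemma reflection_similitude:
  assumes "Q a \<noteq> 0"
  shows "similitude 1 (reflection a)"
proof -
  have "Vector_Spaces.linear (*s) (*s) (reflection a)"
    unfolding Vector_Spaces.linear_iff reflection_def
    by (auto simp: vec.vector_space_axioms vec.scale_right_diff_distrib add_divide_distrib
        distrib_left vec.scale_left_distrib algebra_simps)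
  moreover have inv: "reflection a (reflection a v) = v" for v
  proof -
    have "B (reflection a v) a = - B v a"
      using assms by (simp add: reflection_def Q_eq[symmetric])
    then show ?thesis
      by (simp add: reflection_def)
  qed
  have "bij (reflection a)"
    using inv by (rule involuntory_imp_bij)
  moreover have "Q (reflection a v) = Q v" for v
  proof -
    have "Q (v - c *s a) = Q v - 2 * c * B v a + c * c * Q a" for c
      by (simp add: Q_eq B_sym[of a v] algebra_simps)
    then show ?thesis
      using assms by (simp add: reflection_def power2_eq_square)
  qed
  ultimately show ?thesis
    by (simp add: similitude_def)
qed

lemma reflection_fixes: "B v a = 0 \<Longrightarrow> reflection a v = v"
  by (simp add: reflection_def)

lemma reflection_in: "vec.subspace W \<Longrightarrow> a \<in> W \<Longrightarrow> v \<in> W \<Longrightarrow> reflection a v \<in> W"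
  unfolding reflection_def by (intro vec.subspace_diff vec.subspace_scale)

text \<open>Since Q(z + y) + Q(z - y) = 4 Q(y) is nonzero, one of the two vectors is anisotropic.
  Reflection in \<open>z - y\<close> takes \<open>z\<close> to \<open>y\<close>; reflection in
  \<open>z + y\<close> takes it to \<open>- y\<close>, which the reflection in \<open>y\<close>
  corrects. The clause on fixed vectors serves the induction for Witt's theorem, the clause on
  subspaces \<open>last_value_square\<close>.\<close>

lemma isometry_moving_vector:
  assumes Q: "Q z = Q y" "Q y \<noteq> 0"
  shows "\<exists>h. similitude 1 h \<and> h z = y \<and> (\<forall>v. B v z = 0 \<longrightarrow> B v y = 0 \<longrightarrow> h v = v) \<and>
    (\<forall>W. vec.subspace W \<longrightarrow> z \<in> W \<longrightarrow> y \<in> W \<longrightarrow> h ` W \<subseteq> W)"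
proof (cases "Q (z - y) = 0")
  case False
  have "Q (z - y) = 2 * B z (z - y)"
    using Q by (simp add: Q_eq B_sym[of y z])
  then have "2 * B z (z - y) / Q (z - y) = 1"
    using False by simp
  then have "reflection (z - y) z = y"
    by (simp add: reflection_def)
  moreover have "reflection (z - y) ` W \<subseteq> W" if "vec.subspace W" "z \<in> W" "y \<in> W" for W
    using that by (auto intro: reflection_in vec.subspace_diff)
  ultimately show ?thesis
    using reflection_similitude[OF False]
    by (intro exI[of _ "reflection (z - y)"]) (auto intro: reflection_fixes)
next
  case True
  have "Q (z + y) + Q (z - y) = 4 * Q y"
    using Q by (simp add: Q_eq)
  then have nz: "Q (z + y) \<noteq> 0"
    using True Q four by auto
  have "Q (z + y) = 2 * B z (z + y)"
    using Q by (simp add: Q_eq B_sym[of y z])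
  then have "2 * B z (z + y) / Q (z + y) = 1"
    using nz by simp
  then have "reflection (z + y) z = - y"
    by (simp add: reflection_def)
  moreover have "reflection y (- y) = y"
  proof -
    have "reflection y (- y) = - y + 2 *s y"
      using Q by (simp add: reflection_def flip: Q_eq)
    then show ?thesis
      using vec.scale_left_distrib[of 1 1 y] by simp
  qed
  ultimately have "(reflection y \<circ> reflection (z + y)) z = y"
    by simp
  moreover have "(reflection y \<circ> reflection (z + y)) ` W \<subseteq> W"
    if "vec.subspace W" "z \<in> W" "y \<in> W" for W
    using that by (auto intro!: reflection_in vec.subspace_add)
  moreover have "similitude 1 (reflection y \<circ> reflection (z + y))"
    using similitude_comp[OF reflection_similitude[OF nz] reflection_similitude[OF Q(2)]] by simp
  ultimately show ?thesis
    by (intro exI[of _ "reflection y \<circ> reflection (z + y)"]) (auto simp: reflection_fixes)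
qed

lemma witt_extension:
  "orth xs \<Longrightarrow> orth ys \<Longrightarrow> map Q xs = map Q ys \<Longrightarrow>
    \<exists>g. similitude 1 g \<and> map g xs = ys \<and>
      (\<forall>W. vec.subspace W \<longrightarrow> set xs \<subseteq> W \<longrightarrow> set ys \<subseteq> W \<longrightarrow> g ` W \<subseteq> W)"
proof (induction xs arbitrary: ys rule: rev_induct)
  case Nil
  then show ?case
    by (intro exI[of _ id] conjI similitude_id) simp_all
next
  case (snoc x xs)
  then obtain ys' y where ys: "ys = ys' @ [y]" "map Q xs = map Q ys'" "Q x = Q y"
    by (cases ys rule: rev_cases) auto
  have "orth xs" "orth ys'"
    using snoc.prems ys(1) by (simp_all add: orth_append)
  then obtain g where g: "similitude 1 g" "map g xs = ys'"
    "\<And>W. vec.subspace W \<Longrightarrow> set xs \<subseteq> W \<Longrightarrow> set ys' \<subseteq> W \<Longrightarrow> g ` W \<subseteq> W"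
    using snoc.IH[of ys'] ys(2) by auto
  have "Q (g x) = Q y" "Q y \<noteq> 0"
    using g(1) ys snoc.prems(2) by (auto simp: similitude_def orth_append)
  from isometry_moving_vector[OF this] obtain h where h: "similitude 1 h" "h (g x) = y"
    "\<And>v. B v (g x) = 0 \<Longrightarrow> B v y = 0 \<Longrightarrow> h v = v"
    "\<And>W. vec.subspace W \<Longrightarrow> g x \<in> W \<Longrightarrow> y \<in> W \<Longrightarrow> h ` W \<subseteq> W"
    by auto
  \<comment> \<open>Both \<open>g x\<close> and \<open>y\<close> are orthogonal to the vectors
    already placed, so correcting the last one does not move them.\<close>
  have "h (g v) = g v" if "v \<in> set xs" for v
  proof (rule h(3))
    show "B (g v) (g x) = 0"
      using that snoc.prems(1) similitude_B[OF g(1)] by (auto simp: orth_append)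
    show "B (g v) y = 0"
      using that snoc.prems(2) ys(1) g(2) by (auto simp: orth_append)
  qed
  then have "map (h \<circ> g) (xs @ [x]) = ys"
    using g(2) h(2) ys(1) by auto
  moreover have "(h \<circ> g) ` W \<subseteq> W"
    if "vec.subspace W" "set (xs @ [x]) \<subseteq> W" "set ys \<subseteq> W" for W
  proof -
    have "g ` W \<subseteq> W"
      using that ys g(3) by auto
    moreover from this have "h ` W \<subseteq> W"
      using that ys by (intro h(4)) auto
    ultimately show ?thesis
      by auto
  qed
  moreover have "similitude 1 (h \<circ> g)"
    using similitude_comp[OF g(1) h(1)] by simp
  ultimately show ?case
    by blast
qed

lemma witt_spans:
  assumes "orth xs" "orth ys" "map Q xs = map Q ys"
  shows "\<exists>g. similitude 1 g \<and> g ` vec.span (set xs) = vec.span (set ys)"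
proof -
  obtain g where g: "similitude 1 g" "map g xs = ys"
    using witt_extension[OF assms] by blast
  then have "g ` vec.span (set xs) = vec.span (set ys)"
    using similitude_span[OF g(1)] by auto
  then show ?thesis
    using g(1) by blast
qed

lemma similitude_of_bases:
  assumes xs: "orth xs" "vec.span (set xs) = UNIV" and ys: "orth ys"
    and vals: "map Q ys = map (\<lambda>x. \<mu> * Q x) xs" and \<mu>: "\<mu> \<noteq> 0"
  shows "\<exists>g. similitude \<mu> g"
proof -
  have len: "length ys = length xs"
    using vals map_eq_imp_length_eq by blast
  have ind: "vec.independent (set xs)" and dist: "distinct xs"
    using orth_independent[OF xs(1)] by auto
  obtain g where g: "Vector_Spaces.linear (*s) (*s) g"
    "\<forall>x\<in>set xs. g x = the (map_of (zip xs ys) x)"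
    using vec.linear_independent_extend[OF ind, of "\<lambda>x. the (map_of (zip xs ys) x)"] by blast
  interpret g: Vector_Spaces.linear "(*s)" "(*s)" g
    by (rule g(1))
  have gnth: "g (xs ! i) = ys ! i" if "i < length xs" for i
    using g(2) that len dist by (simp add: map_of_zip_nth)
  then have "map g xs = ys"
    using len by (simp add: list_eq_iff_nth_eq)
  then have orthg: "orth (map g xs)" and Qg: "\<And>x. x \<in> set xs \<Longrightarrow> Q (g x) = \<mu> * Q x"
    using ys vals by auto
  \<comment> \<open>Off the diagonal both sides vanish, as both lists are orthogonal; bilinearity
    then spreads the identity from the basis to all vectors.\<close>
  have "\<forall>x\<in>set zs. \<forall>y\<in>set zs. B (g x) (g y) = \<mu> * B x y"
    if "orth zs" "orth (map g zs)" "\<And>x. x \<in> set zs \<Longrightarrow> Q (g x) = \<mu> * Q x" for zs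
    using that
  proof (induction zs)
    case Nil
    then show ?case by simp
  next
    case (Cons z zs)
    then have "B (g z) (g z) = \<mu> * B z z"
      by (simp flip: Q_eq)
    moreover have "B x z = 0" "B z x = 0" "B (g x) (g z) = 0" "B (g z) (g x) = 0"
      if "x \<in> set zs" for x
      using Cons.prems that by (simp_all add: B_sym[of x z] B_sym[of "g x" "g z"])
    ultimately show ?case
      using Cons by simp
  qed
  from this[OF xs(1) orthg Qg]
  have basis: "B (g x) (g y) = \<mu> * B x y" if "x \<in> set xs" "y \<in> set xs" for x y
    using that by blast
  have basis': "B (g x) (g w) = \<mu> * B x w" if "x \<in> set xs" "w \<in> vec.span (set xs)" for x w
    using that(2)
    by (induction rule: vec.span_induct_alt)
      (auto simp: g.zero g.add g.scale basis that(1) algebra_simps)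
  have "B (g v) (g w) = \<mu> * B v w" if "v \<in> vec.span (set xs)" for v w
    using that by (induction rule: vec.span_induct_alt)
      (auto simp: g.zero g.add g.scale basis' xs(2) algebra_simps)
  then have Bg: "B (g v) (g w) = \<mu> * B v w" for v w
    using xs(2) by simp
  \<comment> \<open>A vector killed by \<open>g\<close> is orthogonal to everything, because the
    multiplier is nonzero.\<close>
  have "v = 0" if "g v = 0" for v
  proof (rule orth_span_zero[OF xs(1)])
    show "v \<in> vec.span (set xs)"
      using xs(2) by simp
    show "B v x = 0" for x
      using Bg[of v x] that \<mu> by simp
  qed
  then have "inj g"
    using g.inj_iff_eq_0 by blast
  then have "bij g"
    by (simp add: bij_def finite_UNIV_inj_surj)
  then show ?thesis
    using g(1) \<mu> Bg Q_eq by (intro exI[of _ g]) (simp add: similitude_def)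
qed

subsection \<open>Types and values of orthogonal bases\<close>

lemma nonsing_isotropic_dims:
  assumes "nonsing W"
  shows "max_isotropic_dim Q W = Max {vec.dim U | U. totally_isotropic Q U \<and> U \<subseteq> W}"
proof -
  have "radical Q W = {0}"
    using assms by (simp add: nonsing_def)
  moreover have "totally_isotropic Q U \<Longrightarrow> 0 \<in> U" for U
    by (simp add: totally_isotropic_def vec.subspace_0)
  ultimately show ?thesis
    unfolding max_isotropic_dim_def by (intro arg_cong[of _ _ Max]) auto
qed

text \<open>Translates the Witt index into lists of values; from here on isotropic subspaces are
  rarely touched.\<close>

lemma hyp_le_max_isotropic_dim:
  assumes W: "nonsing W"
  shows "r \<le> max_isotropic_dim Q W \<longleftrightarrow> (\<exists>xs. orth xs \<and> set xs \<subseteq> W \<and> map Q xs = hyp r)"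
proof -
  define D where "D = {vec.dim U | U. totally_isotropic Q U \<and> U \<subseteq> W}"
  have max: "max_isotropic_dim Q W = Max D"
    unfolding D_def by (rule nonsing_isotropic_dims[OF W])
  have "finite D"
    unfolding D_def by (rule finite_image_set) simp
  have sub: "vec.subspace W"
    using W by (simp add: nonsing_def)
  have "totally_isotropic Q {0}"
    unfolding totally_isotropic_def by (simp add: Q_eq)
  then have "D \<noteq> {}"
    unfolding D_def using vec.subspace_0[OF sub] by blast
  show ?thesis
  proof
    assume "r \<le> max_isotropic_dim Q W"
    moreover obtain U where "totally_isotropic Q U" "U \<subseteq> W" "vec.dim U = Max D"
      using Max_in[OF \<open>finite D\<close> \<open>D \<noteq> {}\<close>] unfolding D_def by auto
    ultimately show "\<exists>xs. orth xs \<and> set xs \<subseteq> W \<and> map Q xs = hyp r"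
      using isotropic_imp_hyp[OF W, of "[]" U r] max by auto
  next
    assume "\<exists>xs. orth xs \<and> set xs \<subseteq> W \<and> map Q xs = hyp r"
    then obtain xs where xs: "orth xs" "set xs \<subseteq> W" "map Q xs = hyp r"
      by blast
    then obtain U where U: "U \<subseteq> vec.span (set xs)" "totally_isotropic Q U" "vec.dim U = r"
      using hyp_imp_isotropic[of xs r "[]"] by auto
    have "U \<subseteq> W"
      using U(1) vec.span_minimal[OF xs(2) sub] by blast
    then have "r \<in> D"
      unfolding D_def using U by blast
    then show "r \<le> max_isotropic_dim Q W"
      using max \<open>finite D\<close> by simp
  qed
qed

lemma max_isotropic_dim_bounds:
  assumes W: "nonsing W"
  shows "2 * max_isotropic_dim Q W \<le> vec.dim W" "vec.dim W \<le> 2 * max_isotropic_dim Q W + 2"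
proof -
  obtain xs where xs: "orth xs" "set xs \<subseteq> W" "map Q xs = hyp (max_isotropic_dim Q W)"
    using hyp_le_max_isotropic_dim[OF W] by blast
  have "length xs = 2 * max_isotropic_dim Q W"
    using arg_cong[OF xs(3), of length] by simp
  then show "2 * max_isotropic_dim Q W \<le> vec.dim W"
    using orth_length_le[OF xs(1,2)] by simp
  show "vec.dim W \<le> 2 * max_isotropic_dim Q W + 2"
  proof (cases "vec.dim W = 0")
    case False
    \<comment> \<open>This is the largest number of pairs that leaves the spare dimension demanded
      by \<open>orth_extend_values\<close>.\<close>
    then have "2 * ((vec.dim W - 1) div 2) < vec.dim W"
      by linarith
    then obtain ys where "orth ys" "set ys \<subseteq> W" "map Q ys = hyp ((vec.dim W - 1) div 2)"
      using orth_extend_values[OF W, of "[]" "hyp ((vec.dim W - 1) div 2)"] hyp_nonzero by auto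
    then have "(vec.dim W - 1) div 2 \<le> max_isotropic_dim Q W"
      using hyp_le_max_isotropic_dim[OF W] by blast
    then show ?thesis
      by linarith
  qed linarith
qed

lemma has_type_nonsing:
  assumes "nonsing W"
  shows "has_type Q W d \<longleftrightarrow>
    odd (vec.dim W) \<and> d = 0 \<or>
    vec.dim W = 2 * max_isotropic_dim Q W \<and> d = 1 \<or>
    vec.dim W = 2 * max_isotropic_dim Q W + 2 \<and> d = - 1"
proof -
  have rad: "vec.dim (radical Q W) = 0"
    using assms nonsing_dim by blast
  show ?thesis
  proof (cases "even (vec.dim W)")
    case True
    then obtain r where r: "vec.dim W = 2 * r"
      by (rule evenE)
    have "int m = int r - 1 \<longleftrightarrow> 2 * r = 2 * m + 2" for m
      by linarith
    then show ?thesis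
      unfolding has_type_def Let_def rad r by auto
  next
    case False
    then have "vec.dim W \<noteq> 2 * m" "vec.dim W \<noteq> 2 * m + 2" for m
      by auto
    then show ?thesis
      unfolding has_type_def Let_def rad using False by simp
  qed
qed

lemma has_type_even:
  assumes "nonsing W" "even (vec.dim W)"
  shows "has_type Q W 1 \<or> has_type Q W (- 1)"
proof -
  obtain r where r: "vec.dim W = 2 * r"
    using assms(2) by (rule evenE)
  have "r = max_isotropic_dim Q W \<or> r = max_isotropic_dim Q W + 1"
    using max_isotropic_dim_bounds[OF assms(1)] r by linarith
  then show ?thesis
    unfolding has_type_nonsing[OF assms(1)] using r by auto
qed

lemma nonsquare_minus_square:
  fixes a \<nu> :: 'a
  assumes \<nu>: "\<nexists>t. \<nu> = t\<^sup>2" and a: "\<nexists>t. a = - t\<^sup>2"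
  shows "\<exists>t. t \<noteq> 0 \<and> - \<nu> = t\<^sup>2 * a"
proof -
  have "\<nexists>t. - a = t\<^sup>2"
    using a by (metis minus_minus)
  from ratio_of_nonsquares[OF this \<nu>] obtain t where "t \<noteq> 0" "\<nu> = - a * t\<^sup>2"
    by blast
  then show ?thesis
    by (intro exI[of _ t]) (simp add: mult.commute)
qed

text \<open>Beside a maximal number of hyperbolic pairs there remains a plane. It contains a vector
  of value 1, and the value of the last vector is determined by maximality up to squares.\<close>

lemma elliptic_values_exist:
  assumes W: "nonsing W" and dim: "vec.dim W = 2 * max_isotropic_dim Q W + 2"
    and \<nu>: "\<nexists>t. \<nu> = t\<^sup>2"
  shows "\<exists>xs. orth xs \<and> set xs \<subseteq> W \<and> map Q xs = hyp (max_isotropic_dim Q W) @ [1, - \<nu>]"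
proof -
  let ?m = "max_isotropic_dim Q W"
  have sub: "vec.subspace W"
    using W by (simp add: nonsing_def)
  obtain xs where xs: "orth xs" "set xs \<subseteq> W" "map Q xs = hyp ?m"
    using hyp_le_max_isotropic_dim[OF W] by blast
  have len: "length xs = 2 * ?m"
    using arg_cong[OF xs(3), of length] by simp
  obtain x where x: "x \<in> W" "orth (xs @ [x])" "Q x = 1"
    using orth_extend_value[OF W xs(1,2), of 1] len dim by auto
  obtain y where y: "y \<in> W" "orth ((xs @ [x]) @ [y])"
    using orth_extend_one[OF W x(2)] x(1) xs(2) len dim by auto
  have scaled: "orth (xs @ [x, t *s y])" if "t \<noteq> 0" for t
    using y(2) that by (auto simp: orth_append)
  have tW: "t *s y \<in> W" for t
    using y(1) sub by (rule vec.subspace_scale[rotated])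
  have "Q y \<noteq> 0"
    using orth_Q[OF y(2)] by simp
  have "\<nexists>t. Q y = - t\<^sup>2"
  proof
    assume "\<exists>t. Q y = - t\<^sup>2"
    then obtain t where t: "Q y = - t\<^sup>2"
      by blast
    then have "t \<noteq> 0"
      using \<open>Q y \<noteq> 0\<close> by auto
    \<comment> \<open>Rescaled to value -1, the last vector would complete one more hyperbolic
      pair.\<close>
    have "map Q (xs @ [x, (1 / t) *s y]) = hyp (Suc ?m)"
      using t \<open>t \<noteq> 0\<close> xs(3) x(3) unfolding hyp_Suc_snoc by (simp add: power_divide)
    moreover have "orth (xs @ [x, (1 / t) *s y])"
      using \<open>t \<noteq> 0\<close> by (intro scaled) simp
    moreover have "set (xs @ [x, (1 / t) *s y]) \<subseteq> W"
      using xs(2) x(1) tW by auto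
    ultimately have "Suc ?m \<le> ?m"
      using hyp_le_max_isotropic_dim[OF W, of "Suc ?m"] by blast
    then show False
      by simp
  qed
  from nonsquare_minus_square[OF \<nu> this] obtain t where "t \<noteq> 0" "- \<nu> = t\<^sup>2 * Q y"
    by blast
  then have "map Q (xs @ [x, t *s y]) = hyp ?m @ [1, - \<nu>]"
    using xs(3) x(3) by simp
  moreover have "set (xs @ [x, t *s y]) \<subseteq> W"
    using xs(2) x(1) tW by auto
  ultimately show ?thesis
    using scaled[OF \<open>t \<noteq> 0\<close>] by blast
qed

text \<open>An isometry from \<open>xs\<close> to \<open>ys\<close> that preserves \<open>W\<close>
  carries the line of \<open>W\<close> orthogonal to \<open>xs\<close> to the one orthogonal to
  \<open>ys\<close>, so it sends \<open>x\<close> to a multiple of \<open>y\<close>.\<close>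

lemma last_value_square:
  assumes W: "nonsing W" and dim: "vec.dim W = Suc (length xs)"
    and xs: "orth (xs @ [x])" "set (xs @ [x]) \<subseteq> W"
    and ys: "orth (ys @ [y])" "set (ys @ [y]) \<subseteq> W"
    and vals: "map Q xs = map Q ys"
  shows "\<exists>t. Q x = t\<^sup>2 * Q y"
proof -
  have sub: "vec.subspace W"
    using W by (simp add: nonsing_def)
  have len: "length xs = length ys"
    using vals map_eq_imp_length_eq by blast
  have o: "orth xs" "orth ys"
    using xs ys by (auto simp: orth_append)
  obtain g where g: "similitude 1 g" "map g xs = ys"
    and gW: "\<And>W. vec.subspace W \<Longrightarrow> set xs \<subseteq> W \<Longrightarrow> set ys \<subseteq> W \<Longrightarrow> g ` W \<subseteq> W"
    using witt_extension[OF o vals] by blast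
  have span: "vec.span (set (ys @ [y])) = W"
    using span_orth_eq[OF ys sub] dim len by simp
  have "g x \<in> W"
    using gW[OF sub] xs(2) ys(2) by auto
  define t where "t = B (g x) y / Q y"
  have Qy: "Q y \<noteq> 0"
    using orth_Q[OF ys(1)] by simp
  have "g x - t *s y = 0"
  proof (rule orth_span_zero[OF ys(1)])
    show "g x - t *s y \<in> vec.span (set (ys @ [y]))"
      unfolding span using \<open>g x \<in> W\<close> ys(2) sub
      by (auto intro: vec.subspace_diff vec.subspace_scale)
  next
    fix z assume "z \<in> set (ys @ [y])"
    then consider "z = y" | "z \<in> set ys"
      by auto
    then show "B (g x - t *s y) z = 0"
    proof cases
      case 1
      then show ?thesis
        using Qy by (simp add: t_def flip: Q_eq)
    next
      case 2
      then obtain w where w: "w \<in> set xs" "z = g w"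
        using g(2) by auto
      have "B x w = 0"
        using w(1) xs(1) B_sym[of x w] by (simp add: orth_append)
      moreover have "B y z = 0"
        using 2 ys(1) B_sym[of y z] by (simp add: orth_append)
      ultimately show ?thesis
        using w(2) similitude_B[OF g(1), of x w] by simp
    qed
  qed
  then have "Q (g x) = t\<^sup>2 * Q y"
    by simp
  then show ?thesis
    using g(1) by (auto simp: similitude_def)
qed

text \<open>With one more hyperbolic pair, \<open>W\<close> would have two orthogonal bases that
  differ only in the last value, -\<nu> against -1; the ratio \<nu> would be a square.\<close>

lemma elliptic_values_type:
  assumes W: "nonsing W" and \<nu>: "\<nexists>t. \<nu> = t\<^sup>2" and dim: "vec.dim W = 2 * r + 2"
    and xs: "orth xs" "set xs \<subseteq> W" "map Q xs = hyp r @ [1, - \<nu>]"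
  shows "max_isotropic_dim Q W = r"
proof (rule ccontr)
  assume neq: "max_isotropic_dim Q W \<noteq> r"
  have "map Q (take (2 * r) xs) = hyp r"
    using arg_cong[OF xs(3), of "take (2 * r)"] by (simp add: take_map)
  moreover have "orth (take (2 * r) xs)"
    using xs(1) orth_append[of "take (2 * r) xs" "drop (2 * r) xs"] by simp
  moreover have "set (take (2 * r) xs) \<subseteq> W"
    using xs(2) set_take_subset[of "2 * r" xs] by blast
  ultimately have "r \<le> max_isotropic_dim Q W"
    using hyp_le_max_isotropic_dim[OF W] by blast
  then have "Suc r \<le> max_isotropic_dim Q W"
    using neq by simp
  then obtain ys where ys: "orth ys" "set ys \<subseteq> W" "map Q ys = hyp (Suc r)"
    using hyp_le_max_isotropic_dim[OF W] by blast
  obtain xs' x where x: "xs = xs' @ [x]" "map Q xs' = hyp r @ [1]" "Q x = - \<nu>"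
    using xs(3) by (cases xs rule: rev_cases) auto
  obtain ys' y where y: "ys = ys' @ [y]" "map Q ys' = hyp r @ [1]" "Q y = - 1"
    using ys(3) unfolding hyp_Suc_snoc by (cases ys rule: rev_cases) auto
  have "length xs' = 2 * r + 1"
    using arg_cong[OF x(2), of length] by simp
  then obtain t where "Q x = t\<^sup>2 * Q y"
    using last_value_square[OF W, of xs' x ys' y] xs(1,2) ys(1,2) x y dim by auto
  then have "\<nu> = t\<^sup>2"
    using x(3) y(3) by simp
  then show False
    using \<nu> by blast
qed

lemma has_type_iff_values:
  assumes W: "nonsing W" and \<nu>: "\<nexists>t. \<nu> = t\<^sup>2" and dim: "vec.dim W = 2 * r"
    and d: "d = 1 \<or> d = - 1"
  shows "has_type Q W d \<longleftrightarrow>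
    (\<exists>xs. orth xs \<and> set xs \<subseteq> W \<and> map Q xs = type_values \<nu> d r)"
proof (cases "d = 1")
  case True
  have "has_type Q W d \<longleftrightarrow> r \<le> max_isotropic_dim Q W"
    using has_type_nonsing[OF W] max_isotropic_dim_bounds(1)[OF W] True dim by auto
  then show ?thesis
    using hyp_le_max_isotropic_dim[OF W] True by (simp add: type_values_def)
next
  case False
  then have d: "d = - 1" and vals: "type_values \<nu> d r = hyp (r - 1) @ [1, - \<nu>]"
    using assms(4) by (auto simp: type_values_def)
  have type: "has_type Q W d \<longleftrightarrow> r = max_isotropic_dim Q W + 1"
    using has_type_nonsing[OF W] d dim by auto
  show ?thesis
  proof
    assume "has_type Q W d"
    then show "\<exists>xs. orth xs \<and> set xs \<subseteq> W \<and> map Q xs = type_values \<nu> d r"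
      using elliptic_values_exist[OF W _ \<nu>] type dim vals by auto
  next
    assume "\<exists>xs. orth xs \<and> set xs \<subseteq> W \<and> map Q xs = type_values \<nu> d r"
    then obtain xs where xs: "orth xs" "set xs \<subseteq> W" "map Q xs = hyp (r - 1) @ [1, - \<nu>]"
      using vals by auto
    \<comment> \<open>The list has at least two entries even where \<open>r - 1\<close> truncates,
      so the dimension excludes \<open>r = 0\<close>.\<close>
    have "length xs = 2 * (r - 1) + 2"
      using arg_cong[OF xs(3), of length] by simp
    then have "r \<ge> 1"
      using orth_length_le[OF xs(1,2)] dim by linarith
    then show "has_type Q W d"
      using elliptic_values_type[OF W \<nu> _ xs] dim type by auto
  qed
qed

subsection \<open>Transitivity of the similitudes\<close>

lemma singular_spaces_0:
  "W \<in> singular_spaces Q 0 j d \<longleftrightarrow> nonsing W \<and> vec.dim W = j \<and> has_type Q W d"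
  unfolding singular_spaces_def nonsing_dim by blast

lemma even_dim_isometric:
  assumes P: "nonsing P" "vec.dim P = 2 * r" "has_type Q P d"
    and P': "nonsing P'" "vec.dim P' = 2 * r" "has_type Q P' d"
  shows "\<exists>g. similitude 1 g \<and> g ` P = P'"
proof -
  obtain \<nu> :: 'a where \<nu>: "\<nexists>t. \<nu> = t\<^sup>2"
    using nonsquare_exists[OF odd_card] by blast
  have d: "d = 1 \<or> d = - 1" and r: "r \<ge> 1 \<or> d = 1"
    using P has_type_nonsing[OF P(1), of d] by auto
  obtain xs where xs: "orth xs" "set xs \<subseteq> P" "map Q xs = type_values \<nu> d r"
    using has_type_iff_values[OF P(1) \<nu> P(2) d] P(3) by blast
  obtain ys where ys: "orth ys" "set ys \<subseteq> P'" "map Q ys = type_values \<nu> d r"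
    using has_type_iff_values[OF P'(1) \<nu> P'(2) d] P'(3) by blast
  have "length xs = 2 * r" "length ys = 2 * r"
    using arg_cong[OF xs(3), of length] arg_cong[OF ys(3), of length] length_type_values[OF r]
    by simp_all
  then have "vec.span (set xs) = P" "vec.span (set ys) = P'"
    using span_orth_eq[OF xs(1,2)] span_orth_eq[OF ys(1,2)] P P' by (auto simp: nonsing_def)
  then show ?thesis
    using witt_spans[OF xs(1) ys(1)] xs(3) ys(3) by simp
qed

lemma odd_dim_basis:
  assumes P: "nonsing P" "vec.dim P = 2 * r + 1"
  obtains xs x where "orth (xs @ [x])" "vec.span (set (xs @ [x])) = P" "map Q xs = hyp r"
proof -
  obtain xs where xs: "orth xs" "set xs \<subseteq> P" "map Q xs = hyp r"
    using orth_extend_values[OF P(1), of "[]" "hyp r"] P(2) hyp_nonzero by auto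
  have len: "length xs = 2 * r"
    using arg_cong[OF xs(3), of length] by simp
  then obtain x where x: "x \<in> P" "orth (xs @ [x])"
    using orth_extend_one[OF P(1) xs(1,2)] P(2) by auto
  then have "vec.span (set (xs @ [x])) = P"
    using span_orth_eq[of "xs @ [x]" P] xs(2) len P by (auto simp: nonsing_def)
  then show ?thesis
    using that x xs by blast
qed

lemma orth_scale_last: "orth (xs @ [x]) \<Longrightarrow> t \<noteq> 0 \<Longrightarrow> orth (xs @ [t *s x])"
  by (auto simp: orth_append)

lemma span_scale_last:
  assumes "t \<noteq> (0::'a)"
  shows "vec.span (set (xs @ [t *s x])) = vec.span (set (xs @ [x]))"
proof -
  have "x = (1 / t) *s (t *s x)"
    using assms by simp
  then have "x \<in> vec.span (set (xs @ [t *s x]))"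
    by (metis vec.span_scale vec.span_base in_set_conv_decomp)
  then show ?thesis
    unfolding vec.span_eq by (auto intro: vec.span_base vec.span_scale)
qed

text \<open>The images of \<open>xs\<close> have values multiplied by \<nu>, no longer 1 and -1. But
  \<open>h\<close> preserves totally isotropic subspaces, so the image of their span has another
  orthogonal basis with the old values.\<close>

lemma orth_similitude_hyp:
  assumes h: "similitude \<nu> h" and xs: "orth (xs @ [x])" "map Q xs = hyp r"
  shows "\<exists>zs. orth (zs @ [h x]) \<and> map Q zs = hyp r \<and> set zs \<subseteq> h ` vec.span (set xs)"
proof -
  have oxs: "orth xs"
    using xs(1) by (simp add: orth_append)
  obtain U where U: "U \<subseteq> vec.span (set xs)" "totally_isotropic Q U" "vec.dim U = r"
    using hyp_imp_isotropic[OF oxs, of r "[]"] xs(2) by auto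
  let ?H = "h ` vec.span (set xs)"
  have H: "?H = vec.span (set (map h xs))"
    using similitude_span[OF h] by simp
  have "nonsing ?H"
    unfolding H using nonsing_orth_span similitude_orth[OF h oxs] by blast
  moreover have "totally_isotropic Q (h ` U)" "h ` U \<subseteq> ?H" "vec.dim (h ` U) = r"
    using U similitude_isotropic[OF h] similitude_dim[OF h] by auto
  ultimately obtain zs where zs: "orth zs" "set zs \<subseteq> ?H" "map Q zs = hyp r"
    using isotropic_imp_hyp[of ?H "[]" "h ` U" r] by auto
  have "B z (h x) = 0" if z: "z \<in> set zs" for z
  proof -
    obtain v where v: "v \<in> vec.span (set xs)" "z = h v"
      using zs(2) z by blast
    have "B x v = 0"
      using xs(1) B_sym[of x] by (intro B_span_zero[OF v(1)]) (auto simp: orth_append)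
    then show ?thesis
      using similitude_B[OF h] v(2) B_sym[of x v] by simp
  qed
  moreover have "Q (h x) \<noteq> 0"
    using orth_Q[OF xs(1)] h by (simp add: similitude_def)
  ultimately show ?thesis
    using zs by (intro exI[of _ zs]) (auto simp: orth_append)
qed

text \<open>If the last values differ by a square, rescaling and an isometry suffice. Otherwise
  \<open>h\<close> is applied first: it keeps the hyperbolic part and multiplies the last value by
  \<nu>, after which the ratio is a square.\<close>

lemma odd_dim_similar:
  assumes P: "nonsing P" "vec.dim P = 2 * r + 1" and P': "nonsing P'" "vec.dim P' = 2 * r + 1"
    and h: "similitude \<nu> h" and \<nu>: "\<nexists>t. \<nu> = t\<^sup>2"
  shows "\<exists>\<mu> g. similitude \<mu> g \<and> g ` P = P'"
proof -
  obtain xs x where xs: "orth (xs @ [x])" "vec.span (set (xs @ [x])) = P" "map Q xs = hyp r"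
    using odd_dim_basis[OF P] .
  obtain ys y where ys: "orth (ys @ [y])" "vec.span (set (ys @ [y])) = P'" "map Q ys = hyp r"
    using odd_dim_basis[OF P'] .
  have Qx: "Q x \<noteq> 0" and Qy: "Q y \<noteq> 0"
    using orth_Q[OF xs(1)] orth_Q[OF ys(1)] by auto
  show ?thesis
  proof (cases "\<exists>t. Q y / Q x = t\<^sup>2")
    case True
    then obtain t where t: "Q y / Q x = t\<^sup>2"
      by blast
    then have "t \<noteq> 0" "Q y = t\<^sup>2 * Q x"
      using Qx Qy by (auto simp: field_simps)
    have "\<exists>g. similitude 1 g \<and> g ` vec.span (set (xs @ [t *s x])) = vec.span (set (ys @ [y]))"
      using xs(3) ys(3) \<open>t \<noteq> 0\<close> \<open>Q y = t\<^sup>2 * Q x\<close>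
      by (intro witt_spans orth_scale_last xs(1) ys(1)) auto
    then show ?thesis
      unfolding span_scale_last[OF \<open>t \<noteq> 0\<close>] xs(2) ys(2) by blast
  next
    case False
    then obtain t where t: "t \<noteq> 0" "Q y / Q x = \<nu> * t\<^sup>2"
      using ratio_of_nonsquares[OF \<nu>] by blast
    then have Q: "Q y = t\<^sup>2 * Q (h x)"
      using Qx h by (simp add: similitude_def field_simps)
    obtain zs where zs: "orth (zs @ [h x])" "map Q zs = hyp r" "set zs \<subseteq> h ` vec.span (set xs)"
      using orth_similitude_hyp[OF h xs(1,3)] by blast
    have "vec.span (set xs) \<subseteq> P"
      unfolding xs(2)[symmetric] by (rule vec.span_mono) auto
    moreover have "x \<in> P"
      unfolding xs(2)[symmetric] by (rule vec.span_base) simp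
    ultimately have "set (zs @ [h x]) \<subseteq> h ` P"
      using zs(3) image_mono[of "vec.span (set xs)" P h] by auto
    moreover have "length zs = 2 * r"
      using arg_cong[OF zs(2), of length] by simp
    moreover have "vec.subspace (h ` P)"
      using similitude_subspace[OF h] P(1) by (simp add: nonsing_def)
    ultimately have span: "vec.span (set (zs @ [h x])) = h ` P"
      using zs(1) similitude_dim[OF h] P(2) by (intro span_orth_eq) auto
    have "\<exists>g. similitude 1 g \<and> g ` vec.span (set (zs @ [t *s h x])) = vec.span (set (ys @ [y]))"
      using zs(2) ys(3) Q by (intro witt_spans orth_scale_last zs(1) ys(1) t(1)) auto
    then obtain g where g: "similitude 1 g" "g ` h ` P = P'"
      unfolding span_scale_last[OF t(1)] span ys(2) by blast
    then show ?thesis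
      using similitude_comp[OF h g(1)]
      by (intro exI[of _ "1 * \<nu>"] exI[of _ "g \<circ> h"]) (simp add: image_comp)
  qed
qed

text \<open>As \<open>n\<close> is even, the common type of \<open>Q\<close> and \<open>Q'\<close>
  gives bases \<open>ys\<close> and \<open>xs\<close> on which they take the same values. The linear
  map from \<open>xs\<close> to \<open>ys\<close> then has multiplier \<nu>.\<close>

lemma nonsquare_similitude:
  assumes V: "nonsing UNIV" and even: "even CARD('n)" and \<nu>: "\<nexists>t. \<nu> = t\<^sup>2"
  shows "\<exists>h. similitude \<nu> h"
proof -
  have \<nu>0: "\<nu> \<noteq> 0"
    using \<nu> by (metis zero_power2)
  obtain r where r: "CARD('n) = 2 * r"
    using even by (rule evenE)
  have dim: "vec.dim (UNIV :: ('a ^ 'n) set) = 2 * r"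
    using r by (simp add: card_cart_basis)
  define Q' where "Q' = (\<lambda>v. \<nu> * Q v)"
  have "symmetric_bilinear (\<lambda>v w. \<nu> * B v w)"
    unfolding symmetric_bilinear_def Vector_Spaces.linear_iff
    by (auto simp: B_sym algebra_simps vec.vector_space_axioms
        vector_space_over_itself.vector_space_axioms)
  then have "quadratic_form Q'"
    unfolding quadratic_form_def Q'_def using Q_eq by auto
  then interpret S: quad_space Q'
    by unfold_locales (rule odd_card)
  have SB: "assoc_form Q' v w = \<nu> * B v w" for v w
    by (simp add: assoc_form_def Q'_def algebra_simps)
  have rad: "radical Q' W = radical Q W" for W
    unfolding radical_def SB using \<nu>0 by simp
  have "totally_isotropic Q' U = totally_isotropic Q U" for U
    unfolding totally_isotropic_def Q'_def using \<nu>0 by simp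
  then have type: "has_type Q' W d = has_type Q W d" for W d
    unfolding has_type_def max_isotropic_dim_def rad by simp
  have S: "S.nonsing UNIV"
    using V by (simp add: S.nonsing_def nonsing_def rad)
  obtain d where d: "d = 1 \<or> d = - 1" "has_type Q UNIV d"
    using has_type_even[OF V] dim by auto
  then have rd: "r \<ge> 1 \<or> d = 1"
    using has_type_nonsing[OF V, of d] dim by auto
  obtain ys where ys: "orth ys" "map Q ys = type_values \<nu> d r"
    using has_type_iff_values[OF V \<nu> dim d(1)] d(2) by blast
  obtain xs where xs: "S.orth xs" "map Q' xs = type_values \<nu> d r"
    using S.has_type_iff_values[OF S \<nu> dim d(1)] d(2) type by blast
  have Q': "Q' v = \<nu> * Q v" for v
    by (simp add: Q'_def)
  have "S.orth zs \<Longrightarrow> orth zs" for zs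
    by (induction zs) (auto simp: SB Q' \<nu>0)
  then have "orth xs"
    using xs(1) by blast
  moreover have "length xs = 2 * r"
    using arg_cong[OF xs(2), of length] length_type_values[OF rd] by simp
  then have "vec.span (set xs) = UNIV"
    using \<open>orth xs\<close> dim by (intro span_orth_eq) auto
  ultimately show ?thesis
    using ys xs(2) \<nu>0 by (intro similitude_of_bases[of xs ys \<nu>]) (auto simp: Q'_def)
qed

section \<open>Orthogonal complements and perp types\<close>

lemma perp_orth_span:
  assumes V: "nonsing UNIV" and o: "orth (xs @ ys)" and span: "vec.span (set (xs @ ys)) = UNIV"
  shows "perp Q (vec.span (set xs)) = vec.span (set ys)"
proof
  show "vec.span (set ys) \<subseteq> perp Q (vec.span (set xs))"
  proof
    fix w assume w: "w \<in> vec.span (set ys)"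
    have "B x w = 0" if "x \<in> set xs" for x
      using o that by (intro B_span_zero[OF w]) (auto simp: orth_append)
    then have "B w v = 0" if "v \<in> vec.span (set xs)" for v
      by (intro B_span_zero[OF that]) (simp add: B_sym[of w])
    then show "w \<in> perp Q (vec.span (set xs))"
      by (simp add: perp_def)
  qed
  show "perp Q (vec.span (set xs)) \<subseteq> vec.span (set ys)"
  proof
    fix w assume w: "w \<in> perp Q (vec.span (set xs))"
    have "orth ys"
      using o by (simp add: orth_append)
    then obtain u where u: "u \<in> vec.span (set ys)" "\<forall>y\<in>set ys. B (w - u) y = 0"
      using orth_projection by blast
    \<comment> \<open>What remains after projecting to the span of \<open>ys\<close> is orthogonal
      to the whole basis.\<close>
    have "w - u = 0"
    proof (rule orth_span_zero[OF o])
      fix z assume "z \<in> set (xs @ ys)"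
      then consider "z \<in> set xs" | "z \<in> set ys"
        by auto
      then show "B (w - u) z = 0"
      proof cases
        case 1
        then have "B w z = 0"
          using w vec.span_base by (auto simp: perp_def)
        moreover have "B z u = 0"
          using o 1 by (intro B_span_zero[OF u(1)]) (auto simp: orth_append)
        ultimately show ?thesis
          by (simp add: B_sym[of u z])
      qed (use u in auto)
    qed (use span in simp)
    then show "w \<in> vec.span (set ys)"
      using u(1) by simp
  qed
qed

lemma nonsing_perp:
  assumes V: "nonsing UNIV" and P: "nonsing P"
  shows "nonsing (perp Q P)" "vec.dim (perp Q P) = CARD('n) - vec.dim P" "perp Q (perp Q P) = P"
proof -
  obtain xs where xs: "orth xs" "set xs \<subseteq> P" "length xs = vec.dim P"
    using orth_extend[OF P, of "[]"] by auto
  have spanP: "vec.span (set xs) = P"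
    using span_orth_eq[OF xs(1,2)] P xs(3) by (simp add: nonsing_def)
  obtain ys where ys: "orth (xs @ ys)" "length xs + length ys = CARD('n)"
    using orth_extend[OF V xs(1)] by (auto simp: card_cart_basis)
  have oys: "orth (ys @ xs)"
    using ys(1) unfolding orth_append by (metis B_sym)
  have span: "vec.span (set (xs @ ys)) = UNIV"
    using ys by (intro span_orth_eq) (auto simp: card_cart_basis)
  then have span': "vec.span (set (ys @ xs)) = UNIV"
    by (simp add: Un_commute)
  have perpP: "perp Q P = vec.span (set ys)"
    using perp_orth_span[OF V ys(1) span] spanP by simp
  have "orth ys"
    using ys(1) by (simp add: orth_append)
  then show "nonsing (perp Q P)" "vec.dim (perp Q P) = CARD('n) - vec.dim P"
    using perpP nonsing_orth_span orth_dim_span ys(2) xs(3) by auto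
  show "perp Q (perp Q P) = P"
    using perp_orth_span[OF V oys span'] spanP perpP by simp
qed

text \<open>The isometry between the perps is one of the whole space, so it commutes with
  \<open>perp\<close>, and taking perps again returns to \<open>P\<close> and
  \<open>P'\<close>.\<close>

lemma perp_type_isometric:
  assumes V: "nonsing UNIV" and P: "nonsing P" "vec.dim P = j" "has_type Q (perp Q P) l"
    and P': "nonsing P'" "vec.dim P' = j" "has_type Q (perp Q P') l"
    and even: "even (CARD('n) - j)"
  shows "\<exists>g. similitude 1 g \<and> g ` P = P'"
proof -
  obtain r where r: "CARD('n) - j = 2 * r"
    using even by (rule evenE)
  obtain g where g: "similitude 1 g" "g ` perp Q P = perp Q P'"
    using even_dim_isometric[of "perp Q P" r l "perp Q P'"] nonsing_perp[OF V] P P' r by auto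
  have "g ` P = g ` perp Q (perp Q P)"
    using nonsing_perp(3)[OF V P(1)] by simp
  also have "\<dots> = perp Q (g ` perp Q P)"
    by (rule similitude_perp[OF g(1), symmetric])
  also have "\<dots> = P'"
    using g(2) nonsing_perp(3)[OF V P'(1)] by simp
  finally show ?thesis
    using g(1) by blast
qed

lemma same_type_similar:
  assumes V: "nonsing UNIV" and even: "even (CARD('n) * j)"
    and P: "P \<in> singular_spaces Q 0 j d" "P' \<in> singular_spaces Q 0 j d"
  shows "\<exists>\<mu> g. similitude \<mu> g \<and> g ` P = P'"
proof (cases "even j")
  case True
  then obtain r where "j = 2 * r"
    by (rule evenE)
  then show ?thesis
    using even_dim_isometric[of P r d P'] P unfolding singular_spaces_0 by auto
next
  case False
  then obtain r where "j = 2 * r + 1"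
    by (rule oddE)
  moreover obtain \<nu> :: 'a where \<nu>: "\<nexists>t. \<nu> = t\<^sup>2"
    using nonsquare_exists[OF odd_card] by blast
  moreover obtain h where "similitude \<nu> h"
    using nonsquare_similitude[OF V _ \<nu>] even False by auto
  ultimately show ?thesis
    using odd_dim_similar P unfolding singular_spaces_0 by blast
qed

text \<open>Lets \<open>alpha\<close> be cancelled in the quotient. The bound
  \<open>j < CARD('n)\<close> is essential: the whole space has only one type.\<close>

lemma singular_space_exists:
  assumes V: "nonsing UNIV" and j: "1 \<le> j" "j < CARD('n)"
    and d: "even j \<and> (d = 1 \<or> d = - 1) \<or> odd j \<and> d = 0"
  shows "\<exists>P. P \<in> singular_spaces Q 0 j d"
proof (cases "even j")
  case True
  then obtain r where r: "j = 2 * r"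
    by (rule evenE)
  obtain \<nu> :: 'a where \<nu>: "\<nexists>t. \<nu> = t\<^sup>2"
    using nonsquare_exists[OF odd_card] by blast
  then have "\<nu> \<noteq> 0"
    by (metis zero_power2)
  then have "0 \<notin> set (type_values \<nu> d r)"
    using hyp_nonzero by (auto simp: type_values_def)
  moreover have len: "length (type_values \<nu> d r) = j"
    using j(1) r by (subst length_type_values) auto
  ultimately obtain xs where xs: "orth xs" "map Q xs = type_values \<nu> d r"
    using orth_extend_values[OF V, of "[]" "type_values \<nu> d r"] j(2)
    by (auto simp: card_cart_basis)
  have "length xs = j"
    using arg_cong[OF xs(2), of length] len by simp
  then have dim: "vec.dim (vec.span (set xs)) = 2 * r"
    using orth_dim_span[OF xs(1)] r by simp
  have "has_type Q (vec.span (set xs)) d"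
    using has_type_iff_values[OF nonsing_orth_span[OF xs(1)] \<nu> dim] xs d True vec.span_superset
    by blast
  then show ?thesis
    unfolding singular_spaces_0 using nonsing_orth_span[OF xs(1)] dim r by blast
next
  case False
  \<comment> \<open>Any nonzero values would do, as every non-singular space of odd dimension has
    type 0.\<close>
  obtain xs where xs: "orth xs" "map Q xs = replicate j 1"
    using orth_extend_values[OF V, of "[]" "replicate j 1"] j(2)
    by (auto simp: card_cart_basis)
  have "length xs = j"
    using arg_cong[OF xs(2), of length] by simp
  then have dim: "vec.dim (vec.span (set xs)) = j"
    using orth_dim_span[OF xs(1)] by simp
  then have "has_type Q (vec.span (set xs)) d"
    using has_type_nonsing[OF nonsing_orth_span[OF xs(1)]] False d by auto
  then show ?thesis
    unfolding singular_spaces_0 using nonsing_orth_span[OF xs(1)] dim by blast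
qed

section \<open>Independence of the chosen space, and the count of pairs\<close>

lemma card_complementary_spaces_eq:
  assumes "\<exists>\<mu> g. similitude \<mu> g \<and> g ` P = P'" "\<exists>\<mu> g. similitude \<mu> g \<and> g ` P' = P"
  shows "card (complementary_spaces Q j P k z h) = card (complementary_spaces Q j P' k z h)"
  using assms similitude_card_complementary_spaces by (metis order_antisym)

lemma gamma_eq:
  assumes V: "nonsing UNIV" and even: "even (CARD('n) * j)" and P: "P \<in> singular_spaces Q 0 j d"
  shows "card (complementary_spaces Q j P k z h) = gamma Q 0 j d k z h"
proof -
  have "(SOME P. P \<in> singular_spaces Q 0 j d) \<in> singular_spaces Q 0 j d"
    using P by (rule someI)
  then show ?thesis
    unfolding gamma_def using same_type_similar[OF V even] P
    by (intro card_complementary_spaces_eq) auto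
qed

lemma gamma_perp_eq:
  assumes V: "nonsing UNIV" and even: "even (CARD('n) - j)"
    and P: "P \<in> singular_perp_spaces Q 0 j d l"
  shows "card (complementary_spaces Q j P k z h) = gamma_perp Q 0 j d l k z h"
proof -
  have similar: "\<exists>\<mu> g. similitude \<mu> g \<and> g ` P = P'"
    if "P \<in> singular_perp_spaces Q 0 j d l" "P' \<in> singular_perp_spaces Q 0 j d l" for P P'
    using that perp_type_isometric[OF V _ _ _ _ _ _ even, of P l P']
    unfolding singular_perp_spaces_def singular_spaces_0 by blast
  have "(SOME P. P \<in> singular_perp_spaces Q 0 j d l) \<in> singular_perp_spaces Q 0 j d l"
    using P by (rule someI)
  then show ?thesis
    unfolding gamma_perp_def by (intro card_complementary_spaces_eq similar P)
qed

end

text \<open>The dimension formula reconciles the two conditions: pairs are tested by the dimension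
  of their span, complementary spaces also by trivial intersection.\<close>

lemma dim_span_Un_Int:
  assumes "vec.subspace P" "vec.subspace S"
    and "vec.dim (vec.span (P \<union> S)) = vec.dim P + vec.dim S"
  shows "S \<inter> P = {0 :: 'a::field ^ 'n}"
proof -
  have "vec.dim {x + y |x y. x \<in> P \<and> y \<in> S} + vec.dim (P \<inter> S) = vec.dim P + vec.dim S"
    by (rule vec.dim_sums_Int[OF assms(1,2)])
  moreover have "vec.span (P \<union> S) = {x + y |x y. x \<in> P \<and> y \<in> S}"
    using assms(1,2) by (simp add: vec.span_Un vec.span_eq_iff[THEN iffD2])
  ultimately have "vec.dim (P \<inter> S) = 0"
    using assms(3) by simp
  then have "P \<inter> S \<subseteq> {0}"
    by simp
  then show ?thesis
    using assms(1,2) vec.subspace_0 by blast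
qed

lemma spanning_pairs_eq:
  "spanning_pairs Q j d k z h =
    (SIGMA P:singular_spaces Q 0 j d. complementary_spaces Q j P k z h)"
proof -
  have "S \<inter> P = {0}"
    if "P \<in> singular_spaces Q 0 j d" "S \<in> singular_spaces Q 0 k z"
      "vec.span (P \<union> S) \<in> singular_spaces Q 0 (j + k) h" for P S
    using that by (intro dim_span_Un_Int) (auto simp: singular_spaces_def)
  then show ?thesis
    unfolding spanning_pairs_def nonsingular_pairs_def complementary_spaces_def
    by (auto simp: add.commute)
qed

lemma card_spanning_pairs:
  fixes Q :: "'a::{field,finite} ^ 'n \<Rightarrow> 'a"
  shows "card (spanning_pairs Q j d k z h) =
    (\<Sum>P\<in>singular_spaces Q 0 j d. card (complementary_spaces Q j P k z h))"
  unfolding spanning_pairs_eq by (rule card_SigmaI) auto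

theorem theorem5p2:
  fixes Q :: "'a::{field,finite} ^ 'n \<Rightarrow> 'a"
    and n j k :: nat
    and \<delta> \<epsilon> \<zeta> \<eta> :: int
  assumes "odd CARD('a)"
    and "CARD('n) = n"
    and "1 \<le> j" and "j \<le> n - 1"
    and "1 \<le> k" and "k \<le> n - 1"
    and "j + k \<le> n"
    and "\<delta> \<in> {0, 1, -1}" and "\<epsilon> \<in> {0, 1, -1}" and "\<zeta> \<in> {0, 1, -1}" and "\<eta> \<in> {0, 1, -1}"
    and "[1 = int n - \<epsilon>] (mod 2)"
    and "[1 = int j - \<delta>] (mod 2)"
    and "[1 = int k - \<zeta>] (mod 2)"
    and "[1 = int (k + j) - \<eta>] (mod 2)"
    and "quadratic_form_of_type Q \<epsilon>"
  shows "rho Q j \<delta> k \<zeta> \<eta> =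
    (if even (n * j)
     then real (gamma Q 0 j \<delta> k \<zeta> \<eta>) / real (alpha Q 0 k \<zeta>)
     else (\<Sum>l\<in>{1, -1}. real (alpha_perp Q 0 j 0 l) * real (gamma_perp Q 0 j 0 l k \<zeta> \<eta>))
          / (real (alpha Q 0 j 0) * real (alpha Q 0 k \<zeta>)))"
proof -
  interpret quad_space Q
    using assms(1,16) by unfold_locales (auto simp: quadratic_form_of_type_def)
  have V: "nonsing UNIV"
    using assms(16) by (simp add: nonsing_def quadratic_form_of_type_def)
  have jn: "j < CARD('n)"
    using assms(2,3,4) by linarith
  \<comment> \<open>The congruence makes \<open>\<delta>\<close> vanish exactly for odd
    \<open>j\<close>, as a type must.\<close>
  have "odd (int j - \<delta>)"
    using assms(13) unfolding cong_def by presburger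
  then have \<delta>: "even j \<and> (\<delta> = 1 \<or> \<delta> = - 1) \<or> odd j \<and> \<delta> = 0"
    using assms(8) by auto
  have pairs: "card (nonsingular_pairs Q j \<delta> k \<zeta>) = alpha Q 0 j \<delta> * alpha Q 0 k \<zeta>"
    by (simp add: nonsingular_pairs_def alpha_def card_cartesian_product)
  show ?thesis
  proof (cases "even (n * j)")
    case True
    then have even: "even (CARD('n) * j)"
      using assms(2) by simp
    have "card (spanning_pairs Q j \<delta> k \<zeta> \<eta>) = alpha Q 0 j \<delta> * gamma Q 0 j \<delta> k \<zeta> \<eta>"
      unfolding card_spanning_pairs alpha_def by (simp add: gamma_eq[OF V even])
    moreover have "alpha Q 0 j \<delta> \<noteq> 0"
      using singular_space_exists[OF V assms(3) jn \<delta>] by (auto simp: alpha_def)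
    ultimately show ?thesis
      unfolding rho_def pairs using True by simp
  next
    case False
    then have odd: "odd n" "odd j" and \<delta>0: "\<delta> = 0"
      using \<delta> by auto
    then have even: "even (CARD('n) - j)"
      using assms(2) jn by simp
    let ?S = "\<lambda>l. singular_perp_spaces Q 0 j 0 l"
    let ?c = "\<lambda>P. card (complementary_spaces Q j P k \<zeta> \<eta>)"
    have "has_type Q (perp Q P) 1 \<or> has_type Q (perp Q P) (- 1)"
      if "P \<in> singular_spaces Q 0 j 0" for P
      using that nonsing_perp[OF V, of P] even by (intro has_type_even) (auto simp: singular_spaces_0)
    then have union: "singular_spaces Q 0 j 0 = ?S 1 \<union> ?S (- 1)"
      by (auto simp: singular_perp_spaces_def)
    have "?S 1 \<inter> ?S (- 1) = {}"
      by (auto simp: singular_perp_spaces_def has_type_def Let_def)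
    then have "card (spanning_pairs Q j 0 k \<zeta> \<eta>) = sum ?c (?S 1) + sum ?c (?S (- 1))"
      unfolding card_spanning_pairs union by (intro sum.union_disjoint) auto
    \<comment> \<open>If no space has perp type \<open>l\<close>, both sides are 0 whatever the
      choice inside \<open>gamma_perp\<close> yields.\<close>
    moreover have "sum ?c (?S l) = alpha_perp Q 0 j 0 l * gamma_perp Q 0 j 0 l k \<zeta> \<eta>" for l
      unfolding alpha_perp_def by (simp add: gamma_perp_eq[OF V even])
    ultimately show ?thesis
      unfolding rho_def pairs using False \<delta>0 by simp
  qed
qed

end
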